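(* Let $\mathcal{L}$ be any set of sequents such that $\mathbf{ACT} \subseteq \mathcal{L} \subseteq \mathbf{ACT}_\omega$ (as sets of sequents). Then $\mathcal{L}$ is undecidable.
   Context: Formulae are built from propositional variables and constants $\mathbf{0},\mathbf{1}$ using binary connectives $\cdot$, $\backslash$, $/$, $\vee$, $\wedge$ and unary ${}^*$. A sequent is an expression $\Gamma\vdash\beta$ where $\Gamma$ is a finite, possibly empty (denoted $\Lambda$), sequence of formulae and $\beta$ is a formula. The calculus $\mathbf{MALC}$ has axioms $\alpha\vdash\alpha$, $\Gamma,\mathbf{0},\Delta\vdash\gamma$, $\Lambda\vdash\mathbf{1}$, and rules: from $\Gamma,\Delta\vdash\gamma$ infer $\Gamma,\mathbf{1},\Delta\vdash\gamma$; from $\Pi\vdash\alpha$ and $\Gamma,\beta,\Delta\vdash\gamma$ infer $\Gamma,\Pi,\alpha\backslash\beta,\Delta\vdash\gamma$ and also $\Gamma,\beta/\alpha,\Pi,\Delta\vdash\gamma$; from $\alpha,\Pi\vdash\beta$ infer $\Pi\vdash\alpha\backslash\beta$; from $\Pi,\alpha\vdash\beta$ infer $\Pi\vdash\beta/\alpha$; from $\Gamma,\alpha,\beta,\Delta\vdash\gamma$ infer $\Gamma,\alpha\cdot\beta,\Delta\vdash\gamma$; from $\Gamma\vdash\alpha$ and $\Delta\vdash\beta$ infer $\Gamma,\Delta\vdash\alpha\cdot\beta$; from $\Gamma,\alpha_i,\Delta\vdash\gamma$ ($i=1,2$) infer $\Gamma,\alpha_1\wedge\alpha_2,\Delta\vdash\gamma$;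 from $\Pi\vdash\alpha_1$ and $\Pi\vdash\alpha_2$ infer $\Pi\vdash\alpha_1\wedge\alpha_2$; from $\Gamma,\alpha_1,\Delta\vdash\gamma$ and $\Gamma,\alpha_2,\Delta\vdash\gamma$ infer $\Gamma,\alpha_1\vee\alpha_2,\Delta\vdash\gamma$; from $\Pi\vdash\alpha_i$ ($i=1,2$) infer $\Pi\vdash\alpha_1\vee\alpha_2$. Action logic $\mathbf{ACT}$ is $\mathbf{MALC}$ extended with: from $\Lambda\vdash\beta$ and $\alpha,\beta\vdash\beta$ infer $\alpha^*\vdash\beta$; cut (from $\Pi\vdash\alpha$ and $\Gamma,\alpha,\Delta\vdash\gamma$ infer $\Gamma,\Pi,\Delta\vdash\gamma$); the axiom $\Lambda\vdash\alpha^*$; from $\Pi\vdash\alpha$ and $\Delta\vdash\alpha^*$ infer $\Pi,\Delta\vdash\alpha^*$. Infinitary action logic $\mathbf{ACT}_\omega$ is $\mathbf{MALC}$ extended with the $\omega$-rule: from $\Gamma,\alpha^n,\Delta\vdash\gamma$ for all $n\in\omega$ infer $\Gamma,\alpha^*,\Delta\vdash\gamma$ (here $\alpha^n$ denotes $n$ consecutive copies of $\alpha$), and, for each $n\ge 0$, from $\Pi_1\vdash\alpha,\dots,\Pi_n\vdash\alpha$ infer $\Pi_1,\dots,\Pi_n\vdash\alpha^*$; derivations in $\mathbf{ACT}_\omega$ are possibly infinite well-founded trees. A calculus is identified with its set of derivable sequents, and a logic is an arbitrary set of sequents. *)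

theory Defs
  imports Main "HOL-Library.Nat_Bijection"
begin

text \<open>\<open>Under \<alpha> \<beta>\<close> is the left division (written with a backslash, \<open>\<alpha>\<close> below \<open>\<beta>\<close>)
  and \<open>Over \<beta> \<alpha>\<close> is the right division \<open>\<beta> / \<alpha>\<close>.\<close>

datatype form =
    Var nat
  | Zero
  | One
  | Prod form form (infixl "\<cdot>" 70)
  | Under form form
  | Over form form
  | Join form form
  | Meet form form
  | Star form

datatype sequent = Sequent "form list" form (infix "\<turnstile>" 50)

text \<open>An additional inference rule is given as the set of its instances \<open>(P, s)\<close>, where
  \<open>P\<close> is the (possibly infinite) set of premises and \<open>s\<close> the conclusion. As the least predicate
  closed under the rules, \<open>MALC_ext R\<close> captures derivability by well-founded, possibly
  infinitely branching, trees.\<close>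

inductive MALC_ext :: "(sequent set \<times> sequent) set \<Rightarrow> sequent \<Rightarrow> bool"
  for R :: "(sequent set \<times> sequent) set" where
  ax: "MALC_ext R ([\<alpha>] \<turnstile> \<alpha>)"
| zeroL: "MALC_ext R (\<Gamma> @ [Zero] @ \<Delta> \<turnstile> \<gamma>)"
| oneR: "MALC_ext R ([] \<turnstile> One)"
| oneL: "MALC_ext R (\<Gamma> @ \<Delta> \<turnstile> \<gamma>) \<Longrightarrow> MALC_ext R (\<Gamma> @ [One] @ \<Delta> \<turnstile> \<gamma>)"
| underL: "MALC_ext R (\<Pi> \<turnstile> \<alpha>) \<Longrightarrow> MALC_ext R (\<Gamma> @ [\<beta>] @ \<Delta> \<turnstile> \<gamma>) \<Longrightarrow>
    MALC_ext R (\<Gamma> @ \<Pi> @ [Under \<alpha> \<beta>] @ \<Delta> \<turnstile> \<gamma>)"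
| overL: "MALC_ext R (\<Pi> \<turnstile> \<alpha>) \<Longrightarrow> MALC_ext R (\<Gamma> @ [\<beta>] @ \<Delta> \<turnstile> \<gamma>) \<Longrightarrow>
    MALC_ext R (\<Gamma> @ [Over \<beta> \<alpha>] @ \<Pi> @ \<Delta> \<turnstile> \<gamma>)"
| underR: "MALC_ext R ([\<alpha>] @ \<Pi> \<turnstile> \<beta>) \<Longrightarrow> MALC_ext R (\<Pi> \<turnstile> Under \<alpha> \<beta>)"
| overR: "MALC_ext R (\<Pi> @ [\<alpha>] \<turnstile> \<beta>) \<Longrightarrow> MALC_ext R (\<Pi> \<turnstile> Over \<beta> \<alpha>)"
| prodL: "MALC_ext R (\<Gamma> @ [\<alpha>, \<beta>] @ \<Delta> \<turnstile> \<gamma>) \<Longrightarrow> MALC_ext R (\<Gamma> @ [\<alpha> \<cdot> \<beta>] @ \<Delta> \<turnstile> \<gamma>)"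
| prodR: "MALC_ext R (\<Gamma> \<turnstile> \<alpha>) \<Longrightarrow> MALC_ext R (\<Delta> \<turnstile> \<beta>) \<Longrightarrow> MALC_ext R (\<Gamma> @ \<Delta> \<turnstile> \<alpha> \<cdot> \<beta>)"
| meetL1: "MALC_ext R (\<Gamma> @ [\<alpha>] @ \<Delta> \<turnstile> \<gamma>) \<Longrightarrow> MALC_ext R (\<Gamma> @ [Meet \<alpha> \<beta>] @ \<Delta> \<turnstile> \<gamma>)"
| meetL2: "MALC_ext R (\<Gamma> @ [\<beta>] @ \<Delta> \<turnstile> \<gamma>) \<Longrightarrow> MALC_ext R (\<Gamma> @ [Meet \<alpha> \<beta>] @ \<Delta> \<turnstile> \<gamma>)"
| meetR: "MALC_ext R (\<Pi> \<turnstile> \<alpha>) \<Longrightarrow> MALC_ext R (\<Pi> \<turnstile> \<beta>) \<Longrightarrow> MALC_ext R (\<Pi> \<turnstile> Meet \<alpha> \<beta>)"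
| joinL: "MALC_ext R (\<Gamma> @ [\<alpha>] @ \<Delta> \<turnstile> \<gamma>) \<Longrightarrow> MALC_ext R (\<Gamma> @ [\<beta>] @ \<Delta> \<turnstile> \<gamma>) \<Longrightarrow>
    MALC_ext R (\<Gamma> @ [Join \<alpha> \<beta>] @ \<Delta> \<turnstile> \<gamma>)"
| joinR1: "MALC_ext R (\<Pi> \<turnstile> \<alpha>) \<Longrightarrow> MALC_ext R (\<Pi> \<turnstile> Join \<alpha> \<beta>)"
| joinR2: "MALC_ext R (\<Pi> \<turnstile> \<beta>) \<Longrightarrow> MALC_ext R (\<Pi> \<turnstile> Join \<alpha> \<beta>)"
| extra: "(P, s) \<in> R \<Longrightarrow> (\<And>p. p \<in> P \<Longrightarrow> MALC_ext R p) \<Longrightarrow> MALC_ext R s"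

definition act_rules :: "(sequent set \<times> sequent) set" where
  "act_rules =
     {({[] \<turnstile> \<beta>, [\<alpha>, \<beta>] \<turnstile> \<beta>}, [Star \<alpha>] \<turnstile> \<beta>) | \<alpha> \<beta>. True}
   \<union> {({\<Pi> \<turnstile> \<alpha>, \<Gamma> @ [\<alpha>] @ \<Delta> \<turnstile> \<gamma>}, \<Gamma> @ \<Pi> @ \<Delta> \<turnstile> \<gamma>) | \<Pi> \<alpha> \<Gamma> \<Delta> \<gamma>. True}
   \<union> {({}, [] \<turnstile> Star \<alpha>) | \<alpha>. True}
   \<union> {({\<Pi> \<turnstile> \<alpha>, \<Delta> \<turnstile> Star \<alpha>}, \<Pi> @ \<Delta> \<turnstile> Star \<alpha>) | \<Pi> \<alpha> \<Delta>. True}"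

definition omega_rules :: "(sequent set \<times> sequent) set" where
  "omega_rules =
     {({\<Gamma> @ replicate n \<alpha> @ \<Delta> \<turnstile> \<gamma> | n. True}, \<Gamma> @ [Star \<alpha>] @ \<Delta> \<turnstile> \<gamma>) | \<Gamma> \<alpha> \<Delta> \<gamma>. True}
   \<union> {({\<Pi> \<turnstile> \<alpha> | \<Pi>. \<Pi> \<in> set \<Pi>s}, concat \<Pi>s \<turnstile> Star \<alpha>) | \<Pi>s \<alpha>. True}"

definition ACT :: "sequent set" where
  "ACT = {s. MALC_ext act_rules s}"

definition ACT_omega :: "sequent set" where
  "ACT_omega = {s. MALC_ext omega_rules s}"

text \<open>Terms for the \<open>\<mu>\<close>-recursive functions. Arities are not tracked by the type; a term applied
  to an argument list of unsuitable length is undefined or ignores superfluous arguments.\<close>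

datatype recf =
    ZeroF
  | SuccF
  | ProjF nat
  | CompF recf "recf list"
  | PrimRecF recf recf
  | MuF recf

text \<open>\<open>rec_eval f xs y\<close>: the partial function denoted by \<open>f\<close> is defined at \<open>xs\<close>, with value \<open>y\<close>.
  The recursion variable and the variable bound by minimisation come first.\<close>

inductive rec_eval :: "recf \<Rightarrow> nat list \<Rightarrow> nat \<Rightarrow> bool" where
  "rec_eval ZeroF xs 0"
| "rec_eval SuccF [x] (Suc x)"
| "i < length xs \<Longrightarrow> rec_eval (ProjF i) xs (xs ! i)"
| "list_all2 (\<lambda>g y. rec_eval g xs y) gs ys \<Longrightarrow> rec_eval f ys z \<Longrightarrow> rec_eval (CompF f gs) xs z"
| "rec_eval f xs y \<Longrightarrow> rec_eval (PrimRecF f g) (0 # xs) y"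
| "rec_eval (PrimRecF f g) (n # xs) r \<Longrightarrow> rec_eval g (n # r # xs) y \<Longrightarrow>
    rec_eval (PrimRecF f g) (Suc n # xs) y"
| "rec_eval f (n # xs) 0 \<Longrightarrow> (\<forall>m<n. \<exists>r. rec_eval f (m # xs) (Suc r)) \<Longrightarrow>
    rec_eval (MuF f) xs n"

definition recursive_set :: "nat set \<Rightarrow> bool" where
  "recursive_set A \<longleftrightarrow> (\<exists>f. \<forall>n. rec_eval f [n] (if n \<in> A then 1 else 0))"

text \<open>An effective Goedel numbering, built from the primitive recursive pairing function
  \<^const>\<open>prod_encode\<close>.\<close>

primrec form_code :: "form \<Rightarrow> nat" where
  "form_code Zero = prod_encode (0, 0)"
| "form_code One = prod_encode (1, 0)"
| "form_code (Var n) = prod_encode (2, n)"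
| "form_code (\<alpha> \<cdot> \<beta>) = prod_encode (3, prod_encode (form_code \<alpha>, form_code \<beta>))"
| "form_code (Under \<alpha> \<beta>) = prod_encode (4, prod_encode (form_code \<alpha>, form_code \<beta>))"
| "form_code (Over \<alpha> \<beta>) = prod_encode (5, prod_encode (form_code \<alpha>, form_code \<beta>))"
| "form_code (Join \<alpha> \<beta>) = prod_encode (6, prod_encode (form_code \<alpha>, form_code \<beta>))"
| "form_code (Meet \<alpha> \<beta>) = prod_encode (7, prod_encode (form_code \<alpha>, form_code \<beta>))"
| "form_code (Star \<alpha>) = prod_encode (8, form_code \<alpha>)"

primrec sequent_code :: "sequent \<Rightarrow> nat" where
  "sequent_code (\<Gamma> \<turnstile> \<beta>) = prod_encode (list_encode (map form_code \<Gamma>), form_code \<beta>)"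

definition decidable :: "sequent set \<Rightarrow> bool" where
  "decidable L \<longleftrightarrow> recursive_set (sequent_code ` L)"

lemma form_code_inject: "form_code \<alpha> = form_code \<beta> \<longleftrightarrow> \<alpha> = \<beta>"
proof (induction \<alpha> arbitrary: \<beta>)
qed (case_tac \<beta>; auto)+

lemma inj_sequent_code: "inj sequent_code"
proof (rule injI)
  fix s t assume eq: "sequent_code s = sequent_code t"
  obtain \<Gamma> \<alpha> \<Delta> \<beta> where st: "s = (\<Gamma> \<turnstile> \<alpha>)" "t = (\<Delta> \<turnstile> \<beta>)"
    by (meson sequent.exhaust)
  with eq have "map form_code \<Gamma> = map form_code \<Delta>" "\<alpha> = \<beta>"
    by (simp_all add: form_code_inject list_encode_eq)
  moreover have "inj form_code"
    by (rule injI) (simp add: form_code_inject)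
  ultimately show "s = t"
    using st by simp
qed

lemma rec_eval_functional: "rec_eval f xs y \<Longrightarrow> rec_eval f xs z \<Longrightarrow> y = z"
proof (induction f xs y arbitrary: z rule: rec_eval.induct)
  case (4 xs gs ys f y)
  from 4(4) obtain ys' where ys': "list_all2 (\<lambda>g y. rec_eval g xs y) gs ys'" "rec_eval f ys' z"
    by (cases rule: rec_eval.cases) auto
  have "ys = ys'"
    using 4(1) ys'(1) by (auto simp: list_all2_conv_all_nth intro!: nth_equalityI)
  then show ?case using 4(2) ys'(2) by blast
next
  case (6 f g n xs r y)
  from 6(5) obtain r' where "rec_eval (PrimRecF f g) (n # xs) r'" "rec_eval g (n # r' # xs) z"
    by (cases rule: rec_eval.cases) auto
  then show ?case using 6(3,4) by metis
next
  case (7 f n xs)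
  from 7(4) have z: "rec_eval f (z # xs) 0 \<and> (\<forall>m<z. \<exists>r. rec_eval f (m # xs) (Suc r))"
    by (cases rule: rec_eval.cases) simp_all
  have "\<not> n < z"
    using z 7(2) by blast
  moreover have "\<not> z < n"
    using z 7(3) by blast
  ultimately show ?case by simp
qed (erule rec_eval.cases; simp)+

end

theory Submission
  imports Defs "HOL-Library.Countable"
begin

text \<open>For a recursive function \<open>f\<close> there is a formula \<open>\<gamma>\<close> such that the sequent
  \<open>#, a, \<dots>, a, \<gamma> \<turnstile> \<zero>\<close> with \<open>x\<close> copies of \<open>a\<close> is not in \<open>ACT_omega\<close> if \<open>f x = 1\<close> and is in \<open>ACT\<close>
  if \<open>f x = 0\<close>. Taking for \<open>f\<close> a decision procedure for \<open>L\<close>, applied to the code of this sequent with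
  \<open>\<gamma>\<close> the formula with code \<open>x\<close>, and then for \<open>x\<close> the code of the formula belonging to \<open>f\<close>, gives a
  contradiction.

  The formula \<open>\<gamma>\<close> is \<open>C \<cdot> (E\<^sup>* \<cdot> F)\<close>, where \<open>E\<close> is a join over the transitions of a counter machine for
  \<open>f\<close>. The star generates all words of transitions, and the sequent says that each of them can be
  caught not to be an accepting run: the meet \<open>C\<close> chooses a register or the control stack to be
  traced, a transition is a meet of divisions that update the traced store, and an impossible
  transition yields \<open>\<zero>\<close>, after which the rest of the word is irrelevant. If the machine rejects, all
  runs have bounded length, so finitely many unfoldings of the star suffice, and these are available
  in \<open>ACT\<close>. If it accepts, the accepting run is not caught, and a phase model refutes the sequent.\<close>

section \<open>Recursive functions on codes\<close>

abbreviation Comp1 :: "recf \<Rightarrow> recf \<Rightarrow> recf" where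
  "Comp1 f g \<equiv> CompF f [g]"

abbreviation Comp2 :: "recf \<Rightarrow> recf \<Rightarrow> recf \<Rightarrow> recf" where
  "Comp2 f g h \<equiv> CompF f [g, h]"

lemma rec_eval_Comp1: "rec_eval g xs y \<Longrightarrow> rec_eval f [y] z \<Longrightarrow> rec_eval (Comp1 f g) xs z"
  by (rule rec_eval.intros(4)[of _ _ "[y]"]) auto

lemma rec_eval_Comp2:
  "rec_eval g xs y \<Longrightarrow> rec_eval h xs y' \<Longrightarrow> rec_eval f [y, y'] z \<Longrightarrow> rec_eval (Comp2 f g h) xs z"
  by (rule rec_eval.intros(4)[of _ _ "[y, y']"]) auto

lemma rec_eval_Proj: "i < length xs \<Longrightarrow> xs ! i = y \<Longrightarrow> rec_eval (ProjF i) xs y"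
  using rec_eval.intros(3) by blast

primrec ConstF :: "nat \<Rightarrow> recf" where
  "ConstF 0 = ZeroF"
| "ConstF (Suc n) = Comp1 SuccF (ConstF n)"

lemma rec_eval_Const: "rec_eval (ConstF n) xs n"
  by (induction n) (auto intro: rec_eval.intros(1,2) rec_eval_Comp1)

section \<open>Arithmetic of pairing and list codes\<close>

definition AddF :: recf where
  "AddF = PrimRecF (ProjF 0) (Comp1 SuccF (ProjF 1))"

lemma rec_eval_Add: "rec_eval AddF [m, n] (m + n)"
proof (induction m)
  case 0
  show ?case
    by (auto simp: AddF_def intro!: rec_eval.intros(5) rec_eval_Proj)
next
  case (Suc m)
  then show ?case
    unfolding AddF_def
    by (auto intro!: rec_eval.intros(2) rec_eval.intros(6)[of _ _ m "[n]" "m + n"]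
        rec_eval_Comp1 rec_eval_Proj)
qed

definition TriangleF :: recf where
  "TriangleF = PrimRecF ZeroF (Comp2 AddF (ProjF 1) (Comp1 SuccF (ProjF 0)))"

lemma rec_eval_Triangle: "rec_eval TriangleF [n] (triangle n)"
proof (induction n)
  case 0
  show ?case
    by (auto simp: TriangleF_def intro: rec_eval.intros)
next
  case (Suc n)
  have "rec_eval (Comp2 AddF (ProjF 1) (Comp1 SuccF (ProjF 0))) [n, triangle n] (triangle n + Suc n)"
    by (rule rec_eval_Comp2[OF _ _ rec_eval_Add])
      (auto intro!: rec_eval_Comp1 rec_eval.intros(2) rec_eval_Proj)
  with Suc show ?case
    by (auto simp: TriangleF_def intro: rec_eval.intros(6))
qed

text \<open>Follows \<open>prod_encode (m, n) = triangle (m + n) + m\<close>.\<close>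

definition PairF :: recf where
  "PairF = Comp2 AddF (Comp1 TriangleF AddF) (ProjF 0)"

lemma rec_eval_Pair: "rec_eval PairF [m, n] (prod_encode (m, n))"
  unfolding PairF_def prod_encode_def
  by (auto intro!: rec_eval_Comp2[OF _ _ rec_eval_Add] rec_eval_Proj
      rec_eval_Comp1[OF rec_eval_Add rec_eval_Triangle])

definition ConsF :: recf where
  "ConsF = Comp1 SuccF PairF"

lemma rec_eval_Cons: "rec_eval ConsF [x, list_encode xs] (list_encode (x # xs))"
  unfolding ConsF_def
  by (auto intro!: rec_eval_Comp1[OF rec_eval_Pair] rec_eval.intros(2))

definition ReplicateF :: "nat \<Rightarrow> recf" where
  "ReplicateF c = PrimRecF (Comp2 ConsF (ProjF 0) ZeroF) (Comp2 ConsF (ConstF c) (ProjF 1))"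

lemma rec_eval_Replicate: "rec_eval (ReplicateF c) [n, y] (list_encode (replicate n c @ [y]))"
proof (induction n)
  case 0
  have "rec_eval (Comp2 ConsF (ProjF 0) ZeroF) [y] (list_encode [y])"
    by (rule rec_eval_Comp2[OF _ _ rec_eval_Cons])
      (auto intro!: rec_eval_Proj rec_eval.intros(1))
  then show ?case
    unfolding ReplicateF_def by (auto intro: rec_eval.intros(5))
next
  case (Suc n)
  have "rec_eval (Comp2 ConsF (ConstF c) (ProjF 1)) [n, list_encode (replicate n c @ [y]), y]
      (list_encode (c # replicate n c @ [y]))"
    by (rule rec_eval_Comp2[OF rec_eval_Const _ rec_eval_Cons])
      (auto intro!: rec_eval_Proj)
  with Suc show ?case
    unfolding ReplicateF_def by (auto simp del: list_encode.simps intro: rec_eval.intros(6))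
qed

text \<open>The last formula of the antecedent enters only through its code, which is
  also used as the number of copies of \<open>\<alpha>\<close>; this is what makes the diagonal argument possible
  without any arithmetisation of machines.\<close>

lemma rec_eval_diag_code:
  "\<exists>f. \<forall>\<gamma>. rec_eval f [form_code \<gamma>]
    (sequent_code ([\<beta>] @ replicate (form_code \<gamma>) \<alpha> @ [\<gamma>] \<turnstile> \<delta>))"
proof (intro exI allI)
  fix \<gamma>
  have r: "rec_eval (Comp2 (ReplicateF (form_code \<alpha>)) (ProjF 0) (ProjF 0)) [form_code \<gamma>]
      (list_encode (replicate (form_code \<gamma>) (form_code \<alpha>) @ [form_code \<gamma>]))"
    by (rule rec_eval_Comp2[OF _ _ rec_eval_Replicate]) (auto intro!: rec_eval_Proj)
  have "rec_eval (Comp2 ConsF (ConstF (form_code \<beta>))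
        (Comp2 (ReplicateF (form_code \<alpha>)) (ProjF 0) (ProjF 0))) [form_code \<gamma>]
      (list_encode (form_code \<beta> # replicate (form_code \<gamma>) (form_code \<alpha>) @ [form_code \<gamma>]))"
    by (rule rec_eval_Comp2[OF rec_eval_Const r rec_eval_Cons])
  from rec_eval_Comp2[OF this rec_eval_Const rec_eval_Pair, of "form_code \<delta>"]
  show "rec_eval (Comp2 PairF (Comp2 ConsF (ConstF (form_code \<beta>))
        (Comp2 (ReplicateF (form_code \<alpha>)) (ProjF 0) (ProjF 0))) (ConstF (form_code \<delta>)))
      [form_code \<gamma>] (sequent_code ([\<beta>] @ replicate (form_code \<gamma>) \<alpha> @ [\<gamma>] \<turnstile> \<delta>))"
    by (simp add: map_replicate_const[symmetric] del: list_encode.simps)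
qed

section \<open>Counter machines\<close>

datatype instr = Inc nat | Dec nat | Loop nat "instr list"

datatype act = Add nat | Sub nat | Tst nat

datatype letter = Step instr "instr list" act | LEnd

type_synonym config = "instr list \<times> (nat \<Rightarrow> nat)"

primrec act_reg :: "act \<Rightarrow> nat" where
  "act_reg (Add r) = r"
| "act_reg (Sub r) = r"
| "act_reg (Tst r) = r"

primrec act_step :: "act \<Rightarrow> (nat \<Rightarrow> nat) \<Rightarrow> (nat \<Rightarrow> nat) option" where
  "act_step (Add r) \<rho> = Some (\<rho>(r := Suc (\<rho> r)))"
| "act_step (Sub r) \<rho> = (if \<rho> r = 0 then None else Some (\<rho>(r := \<rho> r - 1)))"
| "act_step (Tst r) \<rho> = (if \<rho> r = 0 then Some \<rho> else None)"

text \<open>\<open>Step i p a\<close> replaces the instruction \<open>i\<close> on top of the control stack by \<open>p\<close>. A loop is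
  entered by decrementing its register, so \<open>Sub r\<close> blocks on \<open>0\<close> and \<open>Tst r\<close> on nonzero values.\<close>

primrec letters_of :: "instr \<Rightarrow> letter list" where
  "letters_of (Inc r) = [Step (Inc r) [] (Add r)]"
| "letters_of (Dec r) = [Step (Dec r) [] (Sub r)]"
| "letters_of (Loop r p) =
    [Step (Loop r p) (p @ [Loop r p]) (Sub r), Step (Loop r p) [] (Tst r)]"

fun mstep :: "letter \<Rightarrow> config \<Rightarrow> config option" where
  "mstep (Step i p a) (j # cs, \<rho>) =
    (if i = j then map_option (\<lambda>\<rho>'. (p @ cs, \<rho>')) (act_step a \<rho>) else None)"
| "mstep _ _ = None"

fun cstep :: "config \<Rightarrow> config \<Rightarrow> bool" where
  "cstep (j # cs, \<rho>) c \<longleftrightarrow> (\<exists>l\<in>set (letters_of j). mstep l (j # cs, \<rho>) = Some c)"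
| "cstep ([], \<rho>) c \<longleftrightarrow> False"

abbreviation csteps :: "config \<Rightarrow> config \<Rightarrow> bool" where
  "csteps \<equiv> cstep\<^sup>*\<^sup>*"

text \<open>Quantifying over the rest \<open>cs\<close> of the control stack makes programs compose
  by concatenation.\<close>

definition exec :: "instr list \<Rightarrow> (nat \<Rightarrow> nat) \<Rightarrow> (nat \<Rightarrow> nat) \<Rightarrow> bool" where
  "exec p \<rho> \<rho>' \<longleftrightarrow> (\<forall>cs. csteps (p @ cs, \<rho>) (cs, \<rho>'))"

lemma exec_Nil: "exec [] \<rho> \<rho>"
  by (simp add: exec_def)

lemma exec_append: "exec p \<rho> \<rho>' \<Longrightarrow> exec q \<rho>' \<rho>'' \<Longrightarrow> exec (p @ q) \<rho> \<rho>''"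
  unfolding exec_def by (metis append.assoc rtranclp_trans)

lemma exec_Cons: "exec [i] \<rho> \<rho>' \<Longrightarrow> exec q \<rho>' \<rho>'' \<Longrightarrow> exec (i # q) \<rho> \<rho>''"
  using exec_append[of "[i]"] by simp

lemma exec_Inc: "exec [Inc r] \<rho> (\<rho>(r := Suc (\<rho> r)))"
  by (auto simp: exec_def intro!: r_into_rtranclp)

lemma exec_Loop_exit: "\<rho> r = 0 \<Longrightarrow> exec [Loop r p] \<rho> \<rho>"
  by (auto simp: exec_def intro!: r_into_rtranclp)

lemma exec_Loop_enter:
  assumes "\<rho> r = Suc n" "exec p (\<rho>(r := n)) \<rho>'" "exec [Loop r p] \<rho>' \<rho>''"
  shows "exec [Loop r p] \<rho> \<rho>''"
  unfolding exec_def
proof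
  fix cs
  have "cstep ([Loop r p] @ cs, \<rho>) (p @ Loop r p # cs, \<rho>(r := n))"
    using assms(1) by simp
  also have "csteps (p @ Loop r p # cs, \<rho>(r := n)) (Loop r p # cs, \<rho>')"
    using assms(2) by (simp add: exec_def)
  also have "csteps (Loop r p # cs, \<rho>') (cs, \<rho>'')"
    using assms(3) by (simp add: exec_def)
  finally show "csteps ([Loop r p] @ cs, \<rho>) (cs, \<rho>'')" .
qed

section \<open>Loops that move, clear and copy registers\<close>

lemma exec_move:
  "r \<noteq> s \<Longrightarrow> \<rho>' = \<rho>(r := 0, s := \<rho> s + \<rho> r) \<Longrightarrow> exec [Loop r [Inc s]] \<rho> \<rho>'"
proof (induction "\<rho> r" arbitrary: \<rho> \<rho>')
  case 0
  then have "\<rho>' = \<rho>" by auto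
  then show ?case using exec_Loop_exit 0 by metis
next
  case (Suc n)
  show ?case
  proof (rule exec_Loop_enter[where \<rho> = \<rho>, OF Suc(2)[symmetric] exec_Inc])
    show "exec [Loop r [Inc s]] ((\<rho>(r := n))(s := Suc ((\<rho>(r := n)) s))) \<rho>'"
      using Suc(2,3,4) by (intro Suc(1)) (auto simp: fun_eq_iff)
  qed
qed

lemma exec_clear: "\<rho>' = \<rho>(r := 0) \<Longrightarrow> exec [Loop r []] \<rho> \<rho>'"
proof (induction "\<rho> r" arbitrary: \<rho> \<rho>')
  case 0
  then have "\<rho>' = \<rho>" by auto
  then show ?case using exec_Loop_exit 0 by metis
next
  case (Suc n)
  show ?case
    by (rule exec_Loop_enter[where \<rho> = \<rho>, OF Suc(2)[symmetric] exec_Nil])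
      (use Suc(2,3) in \<open>auto intro!: Suc(1)\<close>)
qed

text \<open>The first loop empties \<open>r\<close>, so it also saves the value in the scratch
  register \<open>t\<close>, from which the second loop restores \<open>r\<close>.\<close>

definition copy :: "nat \<Rightarrow> nat \<Rightarrow> nat \<Rightarrow> instr list" where
  "copy r s t = [Loop r [Inc s, Inc t], Loop t [Inc r]]"

lemma exec_copy:
  assumes "r \<noteq> s" "r \<noteq> t" "s \<noteq> t" "\<rho> t = 0" and \<rho>': "\<rho>' = \<rho>(s := \<rho> s + \<rho> r)"
  shows "exec (copy r s t) \<rho> \<rho>'"
proof -
  have *: "exec [Loop r [Inc s, Inc t]] \<sigma> (\<sigma>(r := 0, s := \<sigma> s + \<sigma> r, t := \<sigma> t + \<sigma> r))" for \<sigma>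
  proof (induction "\<sigma> r" arbitrary: \<sigma>)
    case 0
    then have "\<sigma>(r := 0, s := \<sigma> s + \<sigma> r, t := \<sigma> t + \<sigma> r) = \<sigma>" by auto
    then show ?case using exec_Loop_exit 0 by metis
  next
    case (Suc n)
    let ?\<tau> = "\<sigma>(r := n, s := Suc (\<sigma> s), t := Suc (\<sigma> t))"
    have "exec [Inc s, Inc t] (\<sigma>(r := n)) ?\<tau>"
      using exec_Cons[OF exec_Inc exec_Inc, of s t "\<sigma>(r := n)"] assms by simp
    moreover have "exec [Loop r [Inc s, Inc t]] ?\<tau> (?\<tau>(r := 0, s := ?\<tau> s + ?\<tau> r, t := ?\<tau> t + ?\<tau> r))"
      using assms by (intro Suc(1)) auto
    moreover have "?\<tau>(r := 0, s := ?\<tau> s + ?\<tau> r, t := ?\<tau> t + ?\<tau> r)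
        = \<sigma>(r := 0, s := \<sigma> s + \<sigma> r, t := \<sigma> t + \<sigma> r)"
      using assms Suc(2) by (auto simp: fun_eq_iff)
    ultimately show ?case
      using exec_Loop_enter[of \<sigma>, OF Suc(2)[symmetric]] by metis
  qed
  show ?thesis
    unfolding copy_def by (rule exec_Cons[OF * exec_move]) (use assms in \<open>auto simp: fun_eq_iff\<close>)
qed

section \<open>Compiling recursive functions\<close>

text \<open>The compiled program adds the value of the function at the registers \<open>as\<close> to the register
  \<open>out\<close>; registers from \<open>b\<close> on are scratch space, zero before and after.\<close>

primrec compile :: "recf \<Rightarrow> nat list \<Rightarrow> nat \<Rightarrow> nat \<Rightarrow> instr list" where
  "compile ZeroF as out b = []"
| "compile SuccF as out b = copy (hd as) out b @ [Inc out]"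
| "compile (ProjF i) as out b = copy (as ! i) out b"
| "compile (CompF f gs) as out b =
    concat (map2 (\<lambda>h k. h as k (b + length gs)) (map compile gs) [b..<b + length gs])
    @ compile f [b..<b + length gs] out (b + length gs)
    @ map (\<lambda>k. Loop k []) [b..<b + length gs]"
| "compile (PrimRecF f g) as out b =
    compile f (tl as) (b + 1) (b + 4) @ copy (hd as) (b + 3) (b + 2)
    @ [Loop (b + 3) (compile g (b # (b + 1) # tl as) (b + 2) (b + 4)
        @ [Loop (b + 1) [], Loop (b + 2) [Inc (b + 1)], Inc b]),
       Loop (b + 1) [Inc out], Loop b []]"
| "compile (MuF f) as out b =
    compile f (b # as) (b + 1) (b + 2)
    @ [Loop (b + 1) ([Loop (b + 1) [], Inc b] @ compile f (b # as) (b + 1) (b + 2)),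
       Loop b [Inc out]]"

text \<open>Nothing is claimed where \<open>f\<close> is undefined. All register assignments are
  covered because subprograms are called on shifted registers, with partial results already
  stored.\<close>

definition compiles :: "recf \<Rightarrow> bool" where
  "compiles f \<longleftrightarrow> (\<forall>as out b \<rho> y. rec_eval f (map \<rho> as) y \<longrightarrow> set as \<subseteq> {..<b} \<longrightarrow> out < b \<longrightarrow>
    out \<notin> set as \<longrightarrow> (\<forall>r\<ge>b. \<rho> r = 0) \<longrightarrow> exec (compile f as out b) \<rho> (\<rho>(out := \<rho> out + y)))"

lemma compilesD:
  assumes "compiles f" "rec_eval f xs y" "xs = map \<rho> as" "set as \<subseteq> {..<b}" "out < b"
    "out \<notin> set as" "\<And>r. r \<ge> b \<Longrightarrow> \<rho> r = 0" "\<rho>' = \<rho>(out := \<rho> out + y)"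
  shows "exec (compile f as out b) \<rho> \<rho>'"
  using assms unfolding compiles_def by blast

lemma compiles_ZeroF: "compiles ZeroF"
proof -
  have "y = 0" if "rec_eval ZeroF xs y" for xs y
    using that by (cases rule: rec_eval.cases)
  then show ?thesis
    unfolding compiles_def by (fastforce simp: exec_Nil)
qed

lemma compiles_SuccF: "compiles SuccF"
  unfolding compiles_def
proof (intro allI impI)
  fix as :: "nat list" and out b :: nat and \<rho> :: "nat \<Rightarrow> nat" and y
  assume *: "rec_eval SuccF (map \<rho> as) y" "set as \<subseteq> {..<b}" "out < b" "out \<notin> set as" "\<forall>r\<ge>b. \<rho> r = 0"
  from *(1) obtain a where a: "as = [a]" "y = Suc (\<rho> a)"
    by (cases rule: rec_eval.cases) auto
  have "exec (copy a out b) \<rho> (\<rho>(out := \<rho> out + \<rho> a))"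
    using * a by (intro exec_copy) auto
  from exec_append[OF this exec_Inc[of out]] show "exec (compile SuccF as out b) \<rho> (\<rho>(out := \<rho> out + y))"
    using a by simp
qed

lemma compiles_ProjF: "compiles (ProjF i)"
  unfolding compiles_def
proof (intro allI impI)
  fix as :: "nat list" and out b :: nat and \<rho> :: "nat \<Rightarrow> nat" and y
  assume *: "rec_eval (ProjF i) (map \<rho> as) y" "set as \<subseteq> {..<b}" "out < b" "out \<notin> set as" "\<forall>r\<ge>b. \<rho> r = 0"
  from *(1) have a: "i < length as" "y = \<rho> (as ! i)"
    by (auto elim: rec_eval.cases)
  with *(2,4) have "as ! i < b" "as ! i \<noteq> out"
    by (auto dest: nth_mem)
  then show "exec (compile (ProjF i) as out b) \<rho> (\<rho>(out := \<rho> out + y))"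
    unfolding compile.simps using * a by (intro exec_copy) auto
qed

lemma exec_clear_list: "exec (map (\<lambda>k. Loop k []) ks) \<rho> (\<lambda>r. if r \<in> set ks then 0 else \<rho> r)"
proof (induction ks arbitrary: \<rho>)
  case Nil
  then show ?case by (simp add: exec_Nil)
next
  case (Cons k ks)
  from exec_Cons[OF exec_clear[OF refl] Cons.IH]
  have "exec (map (\<lambda>k. Loop k []) (k # ks)) \<rho> (\<lambda>r. if r \<in> set ks then 0 else (\<rho>(k := 0)) r)"
    by simp
  moreover have "(\<lambda>r. if r \<in> set ks then 0 else (\<rho>(k := 0)) r) = (\<lambda>r. if r \<in> set (k # ks) then 0 else \<rho> r)"
    by auto
  ultimately show ?case by simp
qed

text \<open>The arguments lie below \<open>b\<close>, hence below all results, and the scratch space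
  starts at \<open>m\<close>, beyond all results. So no call disturbs the arguments or an earlier
  result.\<close>

lemma exec_compile_list:
  assumes "\<And>g. g \<in> set gs \<Longrightarrow> compiles g" "list_all2 (\<lambda>g y. rec_eval g (map \<rho> as) y) gs ys"
    "set as \<subseteq> {..<b}" "b \<le> k" "k + length gs \<le> m" "\<And>r. r \<ge> k \<Longrightarrow> \<rho> r = 0"
  shows "exec (concat (map2 (\<lambda>h k. h as k m) (map compile gs) [k..<k + length gs])) \<rho>
    (\<lambda>r. if r \<in> {k..<k + length gs} then ys ! (r - k) else \<rho> r)"
  using assms
proof (induction gs arbitrary: k \<rho> ys)
  case Nil
  then show ?case by (simp add: exec_Nil)
next
  case (Cons g gs)
  from Cons.prems(2) obtain y ys' where ys: "ys = y # ys'" "rec_eval g (map \<rho> as) y"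
    "list_all2 (\<lambda>g y. rec_eval g (map \<rho> as) y) gs ys'"
    by (auto simp: list_all2_Cons1)
  let ?\<rho> = "\<rho>(k := y)"
  have m: "map ?\<rho> as = map \<rho> as"
    using Cons.prems(3,4) by auto
  have e1: "exec (compile g as k m) \<rho> ?\<rho>"
    by (rule compilesD[OF Cons.prems(1) ys(2) refl]) (use Cons.prems in auto)
  have g2: "rec_eval g (map \<rho> as) y = rec_eval g (map ?\<rho> as) y" for g y
    by (simp only: m)
  have e2: "exec (concat (map2 (\<lambda>h k. h as k m) (map compile gs) [Suc k..<Suc k + length gs])) ?\<rho>
      (\<lambda>r. if r \<in> {Suc k..<Suc k + length gs} then ys' ! (r - Suc k) else ?\<rho> r)"
    by (rule Cons.IH) (use Cons.prems ys(3) in \<open>auto simp only: m set_simps list.size, auto\<close>)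
  have "(\<lambda>r. if r \<in> {Suc k..<Suc k + length gs} then ys' ! (r - Suc k) else ?\<rho> r)
      = (\<lambda>r. if r \<in> {k..<k + length (g # gs)} then ys ! (r - k) else \<rho> r)"
    by (auto simp: ys(1) fun_eq_iff nth_Cons' Suc_diff_Suc)
  moreover have "[k..<k + length (g # gs)] = k # [Suc k..<Suc k + length gs]"
    by (simp add: upt_rec)
  ultimately show ?case
    using exec_append[OF e1 e2] by simp
qed

lemma compiles_CompF:
  assumes "compiles f" "\<And>g. g \<in> set gs \<Longrightarrow> compiles g"
  shows "compiles (CompF f gs)"
  unfolding compiles_def
proof (intro allI impI)
  fix as :: "nat list" and out b :: nat and \<rho> :: "nat \<Rightarrow> nat" and z
  assume *: "rec_eval (CompF f gs) (map \<rho> as) z" "set as \<subseteq> {..<b}" "out < b" "out \<notin> set as" "\<forall>r\<ge>b. \<rho> r = 0"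
  from *(1) obtain ys where ys: "list_all2 (\<lambda>g y. rec_eval g (map \<rho> as) y) gs ys" "rec_eval f ys z"
    by (cases rule: rec_eval.cases) auto
  let ?m = "b + length gs" and ?\<rho> = "\<lambda>r. if r \<in> {b..<b + length gs} then ys ! (r - b) else \<rho> r"
  have len: "length ys = length gs"
    using ys(1) by (simp add: list_all2_lengthD)
  have e1: "exec (concat (map2 (\<lambda>h k. h as k ?m) (map compile gs) [b..<?m])) \<rho> ?\<rho>"
    by (rule exec_compile_list[OF assms(2) ys(1)]) (use * in auto)
  have e2: "exec (compile f [b..<?m] out ?m) ?\<rho> (?\<rho>(out := ?\<rho> out + z))"
    by (rule compilesD[OF assms(1) ys(2)]) (use * len in \<open>auto intro!: nth_equalityI\<close>)
  have "exec (map (\<lambda>k. Loop k []) [b..<?m]) (?\<rho>(out := ?\<rho> out + z))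
      (\<lambda>r. if r \<in> set [b..<?m] then 0 else (?\<rho>(out := ?\<rho> out + z)) r)"
    by (rule exec_clear_list)
  also have "(\<lambda>r. if r \<in> set [b..<?m] then 0 else (?\<rho>(out := ?\<rho> out + z)) r) = \<rho>(out := \<rho> out + z)"
    using *(3,5) by (auto simp: fun_eq_iff)
  finally have e3: "exec (map (\<lambda>k. Loop k []) [b..<?m]) (?\<rho>(out := ?\<rho> out + z)) (\<rho>(out := \<rho> out + z))" .
  show "exec (compile (CompF f gs) as out b) \<rho> (\<rho>(out := \<rho> out + z))"
    unfolding compile.simps by (rule exec_append[OF e1 exec_append[OF e2 e3]])
qed

lemma csteps_enter: "\<rho> r = Suc n \<Longrightarrow> csteps (Loop r p # cs, \<rho>) (p @ Loop r p # cs, \<rho>(r := n))"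
  by (rule r_into_rtranclp) simp

lemma csteps_exec: "exec p \<rho> \<rho>' \<Longrightarrow> csteps (p @ cs, \<rho>) (cs, \<rho>')"
  by (simp add: exec_def)

text \<open>Register \<open>b\<close> counts the finished rounds, \<open>b + 1\<close> holds the
  current value, \<open>b + 2\<close> receives the next one, and \<open>b + 3\<close> counts the
  rounds that are left.\<close>

lemma compiles_PrimRecF:
  assumes "compiles f" "compiles g"
  shows "compiles (PrimRecF f g)"
  unfolding compiles_def
proof (intro allI impI)
  fix as :: "nat list" and out b :: nat and \<rho> :: "nat \<Rightarrow> nat" and y
  assume *: "rec_eval (PrimRecF f g) (map \<rho> as) y" "set as \<subseteq> {..<b}" "out < b" "out \<notin> set as" "\<forall>r\<ge>b. \<rho> r = 0"
  from *(1) obtain a as' where as: "as = a # as'"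
    by (cases rule: rec_eval.cases) auto
  define body where "body = compile g (b # (b + 1) # as') (b + 2) (b + 4)
        @ [Loop (b + 1) [], Loop (b + 2) [Inc (b + 1)], Inc b]"
  define st where "st i r l = \<rho>(b := i, b + 1 := r, b + 3 := l)" for i r l
  define ini where "ini = compile f as' (b + 1) (b + 4) @ copy a (b + 3) (b + 2)"
  have zero: "\<rho> b = 0" "\<rho> (b + 1) = 0" "\<rho> (b + 2) = 0" "\<rho> (b + 3) = 0"
    using *(5) by auto
  have lt: "x < b" "x \<noteq> out" if "x = a \<or> x \<in> set as'" for x
    using that *(2,4) as by auto
  have m: "map (st i r l) as' = map \<rho> as'" for i r l
    using lt by (fastforce simp: st_def)
  have ini: "exec ini \<rho> (st 0 r (\<rho> a))" if "rec_eval f (map \<rho> as') r" for r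
    unfolding ini_def
  proof (rule exec_append)
    show "exec (compile f as' (b + 1) (b + 4)) \<rho> (\<rho>(b + 1 := r))"
      by (rule compilesD[OF assms(1) that refl])
        (use *(5) zero in \<open>auto dest: lt[OF disjI2]\<close>)
    show "exec (copy a (b + 3) (b + 2)) (\<rho>(b + 1 := r)) (st 0 r (\<rho> a))"
      by (rule exec_copy) (use lt[of a] zero in \<open>auto simp: st_def fun_eq_iff\<close>)
  qed
  have body: "exec body (st i r l) (st (Suc i) r' l)" if "rec_eval g (i # r # map \<rho> as') r'" for i r r' l
  proof -
    have "exec (compile g (b # (b + 1) # as') (b + 2) (b + 4)) (st i r l) ((st i r l)(b + 2 := r'))"
    proof (rule compilesD[OF assms(2) that])
      show "i # r # map \<rho> as' = map (st i r l) (b # (b + 1) # as')"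
        by (simp add: m) (simp add: st_def)
    qed (use *(5) zero in \<open>auto simp: st_def dest: lt[OF disjI2]\<close>)
    moreover have "exec [Loop (b + 1) []] ((st i r l)(b + 2 := r')) ((st i 0 l)(b + 2 := r'))"
      by (rule exec_clear) (auto simp: st_def)
    moreover have "exec [Loop (b + 2) [Inc (b + 1)]] ((st i 0 l)(b + 2 := r')) (st i r' l)"
      by (rule exec_move) (use zero in \<open>auto simp: st_def fun_eq_iff\<close>)
    moreover have "exec [Inc b] (st i r' l) (st (Suc i) r' l)"
      using exec_Inc[of b "st i r' l"] by (simp add: st_def fun_upd_twist)
    ultimately show ?thesis
      unfolding body_def by (meson exec_append exec_Cons)
  qed
  \<comment> \<open>\<open>exec_Loop_enter\<close> argues backwards from the exit of the loop,
    whereas the values of the recursion arise forwards from \<open>0\<close>. So the induction on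
    the finished rounds \<open>n\<close> shows that the loop head is reached with \<open>l\<close>
    rounds left.\<close>
  have loop: "csteps (ini @ Loop (b + 3) body # cs, \<rho>) (Loop (b + 3) body # cs, st n z l)"
    if "rec_eval (PrimRecF f g) (n # map \<rho> as') z" "\<rho> a = n + l" for n z l cs
    using that
  proof (induction n arbitrary: z l)
    case 0
    from 0(1) have "rec_eval f (map \<rho> as') z"
      by (cases rule: rec_eval.cases) auto
    from csteps_exec[OF ini[OF this]] 0(2) show ?case by simp
  next
    case (Suc n)
    from Suc.prems(1) obtain r where r: "rec_eval (PrimRecF f g) (n # map \<rho> as') r"
      "rec_eval g (n # r # map \<rho> as') z"
      by (cases rule: rec_eval.cases) auto
    have "csteps (ini @ Loop (b + 3) body # cs, \<rho>) (Loop (b + 3) body # cs, st n r (Suc l))"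
      by (rule Suc.IH[OF r(1)]) (use Suc.prems in simp)
    also have "csteps \<dots> (body @ Loop (b + 3) body # cs, st n r l)"
      using csteps_enter[of "st n r (Suc l)" "b + 3" l] by (simp add: st_def)
    also have "csteps \<dots> (Loop (b + 3) body # cs, st (Suc n) z l)"
      by (rule csteps_exec[OF body[OF r(2)]])
    finally show ?case .
  qed
  have move_acc: "exec [Loop (b + 1) [Inc out]] (st (\<rho> a) y 0) ((st (\<rho> a) 0 0)(out := \<rho> out + y))"
    by (rule exec_move) (use *(3) in \<open>auto simp: st_def fun_eq_iff\<close>)
  have clear_i: "exec [Loop b []] ((st (\<rho> a) 0 0)(out := \<rho> out + y)) (\<rho>(out := \<rho> out + y))"
    by (rule exec_clear) (use *(3) zero in \<open>auto simp: st_def fun_eq_iff\<close>)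
  have "exec (ini @ [Loop (b + 3) body, Loop (b + 1) [Inc out], Loop b []]) \<rho> (\<rho>(out := \<rho> out + y))"
    unfolding exec_def
  proof
    fix cs
    have c1: "csteps (ini @ Loop (b + 3) body # Loop (b + 1) [Inc out] # Loop b [] # cs, \<rho>)
        (Loop (b + 3) body # Loop (b + 1) [Inc out] # Loop b [] # cs, st (\<rho> a) y 0)"
      using *(1) as by (intro loop) auto
    have c2: "csteps (Loop (b + 3) body # Loop (b + 1) [Inc out] # Loop b [] # cs, st (\<rho> a) y 0)
        (Loop (b + 1) [Inc out] # Loop b [] # cs, st (\<rho> a) y 0)"
      using csteps_exec[OF exec_Loop_exit[of "st (\<rho> a) y 0" "b + 3"]] by (simp add: st_def)
    have c3: "csteps (Loop (b + 1) [Inc out] # Loop b [] # cs, st (\<rho> a) y 0)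
        (cs, \<rho>(out := \<rho> out + y))"
      using csteps_exec[OF exec_Cons[OF move_acc clear_i], of cs] by (simp only: append.simps)
    show "csteps ((ini @ [Loop (b + 3) body, Loop (b + 1) [Inc out], Loop b []]) @ cs, \<rho>)
        (cs, \<rho>(out := \<rho> out + y))"
      using rtranclp_trans[OF c1 rtranclp_trans[OF c2 c3]] by (simp only: append.simps append.assoc)
  qed
  then show "exec (compile (PrimRecF f g) as out b) \<rho> (\<rho>(out := \<rho> out + y))"
    by (simp add: as ini_def body_def)
qed

text \<open>Register \<open>b\<close> holds the candidate and \<open>b + 1\<close> the value of
  \<open>f\<close> there. The loop goes on while this value is positive; entering it only decrements
  the value, so the body first clears the register.\<close>

lemma compiles_MuF:
  assumes "compiles f"
  shows "compiles (MuF f)"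
  unfolding compiles_def
proof (intro allI impI)
  fix as :: "nat list" and out b :: nat and \<rho> :: "nat \<Rightarrow> nat" and y
  assume *: "rec_eval (MuF f) (map \<rho> as) y" "set as \<subseteq> {..<b}" "out < b" "out \<notin> set as" "\<forall>r\<ge>b. \<rho> r = 0"
  from *(1) have y: "rec_eval f (y # map \<rho> as) 0" "\<forall>m<y. \<exists>r. rec_eval f (m # map \<rho> as) (Suc r)"
    by (cases rule: rec_eval.cases; simp)+
  define st where "st i t = \<rho>(b := i, b + 1 := t)" for i t
  define test where "test = compile f (b # as) (b + 1) (b + 2)"
  define body where "body = [Loop (b + 1) [], Inc b] @ test"
  have zero: "\<rho> b = 0" "\<rho> (b + 1) = 0"
    using *(5) by auto
  have lt: "x < b" "x \<noteq> out" if "x \<in> set as" for x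
    using that *(2,4) by auto
  have m: "map (st i t) as = map \<rho> as" for i t
    using lt by (fastforce simp: st_def)
  have test: "exec test (st i 0) (st i t)" if "rec_eval f (i # map \<rho> as) t" for i t
    unfolding test_def
  proof (rule compilesD[OF assms that])
    show "i # map \<rho> as = map (st i 0) (b # as)"
      by (simp add: m) (simp add: st_def)
  qed (use *(5) in \<open>auto simp: st_def dest: lt\<close>)
  have body: "exec body (st i t) (st (Suc i) t')" if "rec_eval f (Suc i # map \<rho> as) t'" for i t t'
  proof -
    have "exec [Loop (b + 1) []] (st i t) (st i 0)"
      by (rule exec_clear) (auto simp: st_def)
    moreover have "exec [Inc b] (st i 0) (st (Suc i) 0)"
      using exec_Inc[of b "st i 0"] by (simp add: st_def fun_upd_twist)
    ultimately show ?thesis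
      unfolding body_def append.simps using test[OF that] by (meson exec_Cons)
  qed
  have loop: "csteps (test @ Loop (b + 1) body # cs, \<rho>) (Loop (b + 1) body # cs, st n t)"
    if "rec_eval f (n # map \<rho> as) t" "n \<le> y" for n t cs
    using that
  proof (induction n arbitrary: t)
    case 0
    have "st 0 0 = \<rho>" using zero by (auto simp: st_def fun_eq_iff)
    with csteps_exec[OF test[OF 0(1)]] show ?case by simp
  next
    case (Suc n)
    \<comment> \<open>Below \<open>y\<close> the value is a successor, so the loop is entered once
      more.\<close>
    then obtain r where r: "rec_eval f (n # map \<rho> as) (Suc r)"
      using y(2) by (meson Suc_le_lessD)
    have "csteps (test @ Loop (b + 1) body # cs, \<rho>) (Loop (b + 1) body # cs, st n (Suc r))"
      by (rule Suc.IH[OF r]) (use Suc.prems in simp)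
    also have "csteps \<dots> (body @ Loop (b + 1) body # cs, st n r)"
      using csteps_enter[of "st n (Suc r)" "b + 1" r] by (simp add: st_def)
    also have "csteps \<dots> (Loop (b + 1) body # cs, st (Suc n) t)"
      by (rule csteps_exec[OF body[OF Suc.prems(1)]])
    finally show ?case .
  qed
  have move_i: "exec [Loop b [Inc out]] (st y 0) (\<rho>(out := \<rho> out + y))"
    by (rule exec_move) (use *(3) zero in \<open>auto simp: st_def fun_eq_iff\<close>)
  have "exec (test @ [Loop (b + 1) body, Loop b [Inc out]]) \<rho> (\<rho>(out := \<rho> out + y))"
    unfolding exec_def
  proof
    fix cs
    have "csteps (test @ Loop (b + 1) body # Loop b [Inc out] # cs, \<rho>)
        (Loop (b + 1) body # Loop b [Inc out] # cs, st y 0)"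
      using y(1) by (intro loop) auto
    also have "csteps \<dots> (Loop b [Inc out] # cs, st y 0)"
      using csteps_exec[OF exec_Loop_exit[of "st y 0" "b + 1"]] by (simp add: st_def)
    also have "csteps \<dots> (cs, \<rho>(out := \<rho> out + y))"
      using csteps_exec[OF move_i, of cs] by (simp only: append.simps)
    finally show "csteps ((test @ [Loop (b + 1) body, Loop b [Inc out]]) @ cs, \<rho>)
        (cs, \<rho>(out := \<rho> out + y))"
      by simp
  qed
  then show "exec (compile (MuF f) as out b) \<rho> (\<rho>(out := \<rho> out + y))"
    by (simp add: test_def body_def)
qed

lemma compiles: "compiles f"
  by (induction f)
    (auto intro: compiles_ZeroF compiles_SuccF compiles_ProjF compiles_CompF compiles_PrimRecF
      compiles_MuF)

text \<open>The final \<open>Dec 1\<close> blocks when the computed value is \<open>0\<close>.\<close>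

definition decider :: "recf \<Rightarrow> instr list" where
  "decider f = compile f [0] 1 2 @ [Dec 1]"

definition input :: "nat \<Rightarrow> nat \<Rightarrow> nat" where
  "input x = (\<lambda>_. 0)(0 := x)"

text \<open>Stops just before the final \<open>Dec 1\<close>, whose success depends on
  \<open>y\<close> being positive.\<close>

lemma decider_steps:
  assumes "rec_eval f [x] y"
  shows "csteps (decider f, input x) ([Dec 1], (input x)(1 := y))"
proof -
  have "exec (compile f [0] 1 2) (input x) ((input x)(1 := y))"
    by (rule compilesD[OF compiles assms]) (auto simp: input_def)
  then show ?thesis
    unfolding decider_def by (rule csteps_exec)
qed

section \<open>The encoding\<close>

text \<open>A word of letters is a claimed run of the machine. It is checked one store at a time: the
  control stack, with bottom \<open>Ctl\<close>, and each register \<open>r\<close>, in unary with digit \<open>Cnt r\<close> and bottom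
  \<open>Bot r\<close>. For a single store \<open>trans\<close> is a deterministic pushdown automaton that rewrites the
  top of the stack, where \<open>None\<close> means that an error has been found in the word.\<close>

datatype sym = Bot nat | Cnt nat | Ctl | Ins instr

instance instr :: countable
  by countable_datatype

instance sym :: countable
  by countable_datatype

text \<open>Symbols of other registers stay unchanged, so the check of one register ignores actions
  on the others. Blocked actions show at the top symbol: \<open>Bot r\<close> means zero and
  \<open>Cnt r\<close> means nonzero.\<close>

primrec act_trans :: "act \<Rightarrow> sym \<Rightarrow> sym list option" where
  "act_trans (Add r) Z = Some (if Z = Cnt r \<or> Z = Bot r then [Cnt r, Z] else [Z])"
| "act_trans (Sub r) Z = (if Z = Bot r then None else Some (if Z = Cnt r then [] else [Z]))"
| "act_trans (Tst r) Z = (if Z = Cnt r then None else Some [Z])"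

text \<open>The control stack is empty at \<open>Ctl\<close>, so a further step is an error there;
  \<open>LEnd\<close> is an error if an instruction is still left.\<close>

fun trans :: "letter \<Rightarrow> sym \<Rightarrow> sym list option" where
  "trans (Step i p a) (Ins j) = (if i = j then Some (map Ins p) else None)"
| "trans (Step i p a) Ctl = None"
| "trans (Step i p a) (Cnt r) = act_trans a (Cnt r)"
| "trans (Step i p a) (Bot r) = act_trans a (Bot r)"
| "trans LEnd (Ins i) = None"
| "trans LEnd Z = Some [Z]"

text \<open>The stores of a run keep their bottom symbols; the value on the empty stack is a
  convention.\<close>

fun pops :: "letter \<Rightarrow> sym list \<Rightarrow> sym list option" where
  "pops l [] = Some []"
| "pops l (Z # s) = map_option (\<lambda>r. r @ s) (trans l Z)"

definition ctl :: "instr list \<Rightarrow> sym list" where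
  "ctl cs = map Ins cs @ [Ctl]"

definition reg :: "nat \<Rightarrow> (nat \<Rightarrow> nat) \<Rightarrow> sym list" where
  "reg r \<rho> = replicate (\<rho> r) (Cnt r) @ [Bot r]"

fun msteps :: "letter list \<Rightarrow> config \<Rightarrow> config option" where
  "msteps [] c = Some c"
| "msteps (l # w) c = Option.bind (mstep l c) (msteps w)"

lemma msteps_append: "msteps (v @ w) c = Option.bind (msteps v c) (msteps w)"
  by (induction v arbitrary: c) (auto split: bind_split)

section \<open>Machine steps as seen by single stores\<close>

lemma mstep_Some:
  "mstep l (cs, \<rho>) = Some (cs', \<rho>') \<longleftrightarrow>
    (\<exists>i p a cs0. l = Step i p a \<and> cs = i # cs0 \<and> act_step a \<rho> = Some \<rho>' \<and> cs' = p @ cs0)"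
  by (cases l; cases cs) auto

lemma pops_ctl: "mstep l (cs, \<rho>) = Some (cs', \<rho>') \<Longrightarrow> pops l (ctl cs) = Some (ctl cs')"
  by (auto simp: mstep_Some ctl_def)

lemma pops_reg: "mstep l (cs, \<rho>) = Some (cs', \<rho>') \<Longrightarrow> pops l (reg r \<rho>) = Some (reg r \<rho>')"
proof -
  assume "mstep l (cs, \<rho>) = Some (cs', \<rho>')"
  then obtain i p a where "l = Step i p a" "act_step a \<rho> = Some \<rho>'"
    by (auto simp: mstep_Some)
  then show ?thesis
    by (cases a; cases "\<rho> r") (auto simp: reg_def split: if_splits)
qed

text \<open>A step fails for one of two reasons: a wrong or missing top instruction, seen on the
  control stack, or a blocked action, seen on its register. So a single store always exposes
  it.\<close>

lemma pops_error:
  "mstep (Step i p a) (cs, \<rho>) = None \<Longrightarrow>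
    pops (Step i p a) (ctl cs) = None \<or> pops (Step i p a) (reg (act_reg a) \<rho>) = None"
  by (cases cs; cases a; cases "\<rho> (act_reg a)") (auto simp: ctl_def reg_def split: if_splits)

lemma pops_append: "s \<noteq> [] \<Longrightarrow> pops l (s @ t) = map_option (\<lambda>u. u @ t) (pops l s)"
  by (cases s) (auto simp: option.map_comp comp_def)

section \<open>The finite alphabet of a program\<close>

primrec subs :: "instr \<Rightarrow> instr list" where
  "subs (Inc r) = [Inc r]"
| "subs (Dec r) = [Dec r]"
| "subs (Loop r p) = Loop r p # concat (map subs p)"

lemma subs_self: "i \<in> set (subs i)"
  by (cases i) auto

lemma subs_trans: "j \<in> set (subs i) \<Longrightarrow> set (subs j) \<subseteq> set (subs i)"
proof (induction i arbitrary: j)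
  case (Loop r p)
  show ?case
  proof (cases "j = Loop r p")
    case False
    with Loop.prems obtain k where "k \<in> set p" "j \<in> set (subs k)" by auto
    with Loop.IH[of k j] show ?thesis by auto
  qed simp
qed auto

text \<open>A step pushes at most a loop and its body, so the control stack never leaves this finite
  list. This is what lets the meets and joins below be formulas.\<close>

definition instrs :: "instr list \<Rightarrow> instr list" where
  "instrs p = concat (map subs p)"

definition letters :: "instr list \<Rightarrow> letter list" where
  "letters p = concat (map letters_of (instrs p))"

primrec letter_reg :: "letter \<Rightarrow> nat" where
  "letter_reg (Step i p a) = act_reg a"
| "letter_reg LEnd = 0"

definition regs :: "instr list \<Rightarrow> nat list" where
  "regs p = map letter_reg (letters p)"

definition syms :: "instr list \<Rightarrow> sym list" where
  "syms p = Ctl # map Ins (instrs p) @ map Cnt (regs p) @ map Bot (regs p)"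

lemma instrs_superset: "set p \<subseteq> set (instrs p)"
  using subs_self by (auto simp: instrs_def)

lemma letters_of_Step: "l \<in> set (letters_of i) \<Longrightarrow> \<exists>p a. l = Step i p a"
  by (cases i) auto

lemma instrs_closed:
  assumes "Step i q a \<in> set (letters p)"
  shows "i \<in> set (instrs p)" "set q \<subseteq> set (instrs p)"
proof -
  from assms obtain j where j: "j \<in> set (instrs p)" "Step i q a \<in> set (letters_of j)"
    by (auto simp: letters_def)
  with letters_of_Step have [simp]: "j = i" by blast
  from j show "i \<in> set (instrs p)" by simp
  from j(2) have "set q \<subseteq> set (subs i)"
    by (cases i) (auto intro: subs_self)
  also from j(1) have "set (subs i) \<subseteq> set (instrs p)"
    unfolding instrs_def using subs_trans by fastforce
  finally show "set q \<subseteq> set (instrs p)" .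
qed

lemma mstep_closed:
  "mstep l (cs, \<rho>) = Some (cs', \<rho>') \<Longrightarrow> l \<in> set (letters p) \<Longrightarrow> set cs \<subseteq> set (instrs p) \<Longrightarrow>
    set cs' \<subseteq> set (instrs p)"
  using instrs_closed by (fastforce simp: mstep_Some)

section \<open>Formulas for stacks, letters and programs\<close>

definition vsym :: "sym \<Rightarrow> form" where
  "vsym Z = Var (to_nat Z)"

definition prods :: "sym list \<Rightarrow> form" where
  "prods zs = foldr (\<lambda>Z \<alpha>. vsym Z \<cdot> \<alpha>) zs One"

text \<open>\<open>Under Zero Zero\<close> is a top element and serves as the empty meet.\<close>

definition meets :: "form list \<Rightarrow> form" where
  "meets \<alpha>s = foldr Meet \<alpha>s (Under Zero Zero)"

definition joins :: "form list \<Rightarrow> form" where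
  "joins \<alpha>s = foldr Join \<alpha>s Zero"

text \<open>In the antecedent a stack stands with its top at the right, next to the letter that acts
  on it; hence the left division and the \<open>rev\<close>.\<close>

definition rule_form :: "letter \<Rightarrow> sym \<Rightarrow> form" where
  "rule_form l Z = Under (vsym Z) (case trans l Z of None \<Rightarrow> Zero | Some s \<Rightarrow> prods (rev s))"

definition letter_form :: "instr list \<Rightarrow> letter \<Rightarrow> form" where
  "letter_form p l = meets (map (rule_form l) (syms p))"

text \<open>The stacks with which a check can start. Register \<open>0\<close> holds the input and is part of
  the sequent already, so its check pushes nothing.\<close>

definition starts :: "instr list \<Rightarrow> sym list list" where
  "starts p = [] # ctl p # map (\<lambda>r. [Bot r]) (filter (\<lambda>r. r \<noteq> 0) (regs p))"

definition start_form :: "instr list \<Rightarrow> form" where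
  "start_form p = meets (map (\<lambda>s. prods (rev s)) (starts p))"

definition word_form :: "instr list \<Rightarrow> form" where
  "word_form p = joins (map (letter_form p) (letters p))"

definition program_form :: "instr list \<Rightarrow> form" where
  "program_form p = start_form p \<cdot> (Star (word_form p) \<cdot> letter_form p LEnd)"

definition run_sequent :: "nat \<Rightarrow> form \<Rightarrow> sequent" where
  "run_sequent x \<gamma> = ([vsym (Bot 0)] @ replicate x (vsym (Cnt 0)) @ [\<gamma>] \<turnstile> Zero)"

lemma map_vsym_input: "map vsym (rev (reg 0 (input x))) = [vsym (Bot 0)] @ replicate x (vsym (Cnt 0))"
  by (simp add: reg_def input_def)

section \<open>Rejecting runs give derivations in ACT\<close>

lemma meets_left:
  assumes "\<alpha> \<in> set \<alpha>s" "MALC_ext R (\<Gamma> @ [\<alpha>] @ \<Delta> \<turnstile> \<gamma>)"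
  shows "MALC_ext R (\<Gamma> @ [meets \<alpha>s] @ \<Delta> \<turnstile> \<gamma>)"
  using assms(1)
proof (induction \<alpha>s)
  case (Cons \<beta> \<alpha>s)
  show ?case
  proof (cases "\<alpha> = \<beta>")
    case True
    then show ?thesis
      using MALC_ext.meetL1[OF assms(2)] by (simp add: meets_def)
  next
    case False
    with Cons have "MALC_ext R (\<Gamma> @ [meets \<alpha>s] @ \<Delta> \<turnstile> \<gamma>)" by simp
    then show ?thesis
      using MALC_ext.meetL2 by (simp add: meets_def)
  qed
qed simp

lemma joins_left:
  "(\<And>\<alpha>. \<alpha> \<in> set \<alpha>s \<Longrightarrow> MALC_ext R (\<Gamma> @ [\<alpha>] @ \<Delta> \<turnstile> \<gamma>)) \<Longrightarrow> MALC_ext R (\<Gamma> @ [joins \<alpha>s] @ \<Delta> \<turnstile> \<gamma>)"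
proof (induction \<alpha>s)
  case Nil
  show ?case
    unfolding joins_def foldr.simps id_apply by (rule MALC_ext.zeroL)
next
  case (Cons \<beta> \<alpha>s)
  then show ?case
    using MALC_ext.joinL[of R \<Gamma> \<beta> \<Delta> \<gamma> "joins \<alpha>s"] by (simp add: joins_def)
qed

lemma prods_left:
  "MALC_ext R (\<Gamma> @ map vsym zs @ \<Delta> \<turnstile> \<gamma>) \<Longrightarrow> MALC_ext R (\<Gamma> @ [prods zs] @ \<Delta> \<turnstile> \<gamma>)"
proof (induction zs arbitrary: \<Gamma>)
  case Nil
  then show ?case
    using MALC_ext.oneL[of R \<Gamma> \<Delta> \<gamma>] by (simp add: prods_def)
next
  case (Cons z zs)
  from Cons.IH[of "\<Gamma> @ [vsym z]"] Cons.prems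
  show ?case
    using MALC_ext.prodL[of R \<Gamma> "vsym z" "prods zs"] by (simp add: prods_def)
qed

text \<open>The meet offers the division by the actual top symbol, which consumes
  \<open>vsym Z\<close>; an impossible letter leaves \<open>Zero\<close>, which closes the
  branch.\<close>

lemma letter_left:
  assumes "Z \<in> set (syms p)"
    and "\<And>s. trans l Z = Some s \<Longrightarrow> MALC_ext R (\<Gamma> @ map vsym (rev s) @ \<Delta> \<turnstile> \<gamma>)"
  shows "MALC_ext R (\<Gamma> @ [vsym Z] @ [letter_form p l] @ \<Delta> \<turnstile> \<gamma>)"
proof -
  let ?r = "case trans l Z of None \<Rightarrow> Zero | Some s \<Rightarrow> prods (rev s)"
  have "MALC_ext R (\<Gamma> @ [?r] @ \<Delta> \<turnstile> \<gamma>)"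
    using MALC_ext.zeroL[of R \<Gamma> \<Delta> \<gamma>] prods_left[OF assms(2)]
    by (auto split: option.split)
  from MALC_ext.underL[OF MALC_ext.ax[of R "vsym Z"] this]
  have "MALC_ext R ((\<Gamma> @ [vsym Z]) @ [rule_form l Z] @ \<Delta> \<turnstile> \<gamma>)"
    by (simp add: rule_form_def)
  from meets_left[OF _ this, of "map (rule_form l) (syms p)"] assms(1)
  show ?thesis
    by (simp add: letter_form_def)
qed

lemma letter_stack_left:
  assumes "s \<noteq> []" "hd s \<in> set (syms p)"
    and "\<And>s'. pops l s = Some s' \<Longrightarrow> MALC_ext R (\<Gamma> @ map vsym (rev s') @ \<Delta> \<turnstile> \<gamma>)"
  shows "MALC_ext R (\<Gamma> @ map vsym (rev s) @ [letter_form p l] @ \<Delta> \<turnstile> \<gamma>)"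
proof -
  obtain Z s0 where s: "s = Z # s0"
    using assms(1) by (cases s) auto
  have "MALC_ext R ((\<Gamma> @ map vsym (rev s0)) @ [vsym Z] @ [letter_form p l] @ \<Delta> \<turnstile> \<gamma>)"
  proof (rule letter_left)
    show "Z \<in> set (syms p)" using assms(2) s by simp
    fix t assume "trans l Z = Some t"
    then show "MALC_ext R ((\<Gamma> @ map vsym (rev s0)) @ map vsym (rev t) @ \<Delta> \<turnstile> \<gamma>)"
      using assms(3)[of "t @ s0"] s by simp
  qed
  then show ?thesis using s by simp
qed

lemma ctl_hd: "set cs \<subseteq> set (instrs p) \<Longrightarrow> ctl cs \<noteq> [] \<and> hd (ctl cs) \<in> set (syms p)"
  by (cases cs) (auto simp: ctl_def syms_def)

lemma reg_hd: "r \<in> set (regs p) \<Longrightarrow> reg r \<rho> \<noteq> [] \<and> hd (reg r \<rho>) \<in> set (syms p)"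
  by (cases "\<rho> r") (auto simp: reg_def syms_def)

text \<open>Traces the control stack along a legal run; \<open>mstep_closed\<close> keeps its top
  among the symbols for which letters have a conjunct.\<close>

lemma word_left_ctl:
  assumes "msteps w (cs, \<rho>) = Some (cs', \<rho>')" "set w \<subseteq> set (letters p)" "set cs \<subseteq> set (instrs p)"
    and "set cs' \<subseteq> set (instrs p) \<Longrightarrow> MALC_ext R (\<Gamma> @ map vsym (rev (ctl cs')) @ \<Delta> \<turnstile> \<gamma>)"
  shows "MALC_ext R (\<Gamma> @ map vsym (rev (ctl cs)) @ map (letter_form p) w @ \<Delta> \<turnstile> \<gamma>)"
  using assms(1-3)
proof (induction w arbitrary: cs \<rho>)
  case Nil
  then show ?case using assms(4) by simp
next
  case (Cons l w)
  from Cons.prems(1) obtain cs1 \<rho>1 where 1: "mstep l (cs, \<rho>) = Some (cs1, \<rho>1)"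
    "msteps w (cs1, \<rho>1) = Some (cs', \<rho>')"
    by (auto split: bind_splits)
  have "MALC_ext R (\<Gamma> @ map vsym (rev (ctl cs1)) @ map (letter_form p) w @ \<Delta> \<turnstile> \<gamma>)"
    using Cons.IH[OF 1(2)] mstep_closed[OF 1(1)] Cons.prems by simp
  with letter_stack_left[of "ctl cs" p l R \<Gamma>] ctl_hd[OF Cons.prems(3)] pops_ctl[OF 1(1)]
  show ?case by auto
qed

lemma word_left_reg:
  assumes "msteps w (cs, \<rho>) = Some (cs', \<rho>')" "r \<in> set (regs p)"
    and "MALC_ext R (\<Gamma> @ map vsym (rev (reg r \<rho>')) @ \<Delta> \<turnstile> \<gamma>)"
  shows "MALC_ext R (\<Gamma> @ map vsym (rev (reg r \<rho>)) @ map (letter_form p) w @ \<Delta> \<turnstile> \<gamma>)"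
  using assms(1)
proof (induction w arbitrary: cs \<rho>)
  case Nil
  then show ?case using assms(3) by simp
next
  case (Cons l w)
  from Cons.prems(1) obtain cs1 \<rho>1 where 1: "mstep l (cs, \<rho>) = Some (cs1, \<rho>1)"
    "msteps w (cs1, \<rho>1) = Some (cs', \<rho>')"
    by (auto split: bind_splits)
  with letter_stack_left[of "reg r \<rho>" p l R \<Gamma>] reg_hd[OF assms(2)] pops_reg[OF 1(1)] Cons.IH[OF 1(2)]
  show ?case by auto
qed

lemma start_left_ctl:
  "MALC_ext R (\<Gamma> @ map vsym (rev (ctl p)) @ \<Delta> \<turnstile> \<gamma>) \<Longrightarrow> MALC_ext R (\<Gamma> @ [start_form p] @ \<Delta> \<turnstile> \<gamma>)"
  unfolding start_form_def
  by (rule meets_left[OF _ prods_left]) (auto simp: starts_def)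

text \<open>The unary input is itself the stack to be traced if \<open>r = 0\<close>, and otherwise
  stays inert to the left of the new stack \<open>[Bot r]\<close>; so the premise speaks of all left
  contexts.\<close>

lemma start_left_reg:
  assumes "r \<in> set (regs p)" "\<And>\<Gamma>. MALC_ext R (\<Gamma> @ map vsym (rev (reg r (input x))) @ \<Delta> \<turnstile> \<gamma>)"
  shows "MALC_ext R (map vsym (rev (reg 0 (input x))) @ [start_form p] @ \<Delta> \<turnstile> \<gamma>)"
proof (cases "r = 0")
  case True
  then have "MALC_ext R (map vsym (rev (reg 0 (input x))) @ [prods (rev [])] @ \<Delta> \<turnstile> \<gamma>)"
    using assms(2)[of "[]"] by (intro prods_left) simp
  then show ?thesis
    unfolding start_form_def by (rule meets_left[rotated]) (simp add: starts_def)
next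
  case False
  then have "reg r (input x) = [Bot r]"
    by (simp add: reg_def input_def)
  then have "MALC_ext R (map vsym (rev (reg 0 (input x))) @ [prods (rev [Bot r])] @ \<Delta> \<turnstile> \<gamma>)"
    using assms(2) by (intro prods_left) simp
  moreover have "prods (rev [Bot r]) \<in> set (map (\<lambda>s. prods (rev s)) (starts p))"
    using assms(1) False by (force simp: starts_def)
  ultimately show ?thesis
    unfolding start_form_def by (rule meets_left[rotated])
qed

text \<open>The faulty letter is exposed by one store. That store is chosen at
  \<open>start_form p\<close> and traced through \<open>w\<close>; then \<open>Zero\<close> appears,
  whatever \<Delta> and \<gamma> are.\<close>

lemma run_error:
  assumes "msteps w (p, input x) = Some c" "set w \<subseteq> set (letters p)"
    and "l = LEnd \<and> fst c \<noteq> [] \<or> l \<in> set (letters p) \<and> mstep l c = None"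
  shows "MALC_ext R (map vsym (rev (reg 0 (input x))) @ [start_form p] @
    map (letter_form p) w @ [letter_form p l] @ \<Delta> \<turnstile> \<gamma>)"
proof -
  obtain cs \<rho> where c: "c = (cs, \<rho>)" by fastforce
  have "pops l (ctl cs) = None \<or> pops l (reg (letter_reg l) \<rho>) = None \<and> l \<in> set (letters p)"
  proof (cases l)
    case (Step i q a)
    then show ?thesis using assms(3) pops_error[of i q a cs \<rho>] c by auto
  next
    case LEnd
    have "LEnd \<notin> set (letters p)"
      by (auto simp: letters_def dest: letters_of_Step)
    then show ?thesis using LEnd assms(3) c by (cases cs) (auto simp: ctl_def)
  qed
  then show ?thesis
  proof
    assume *: "pops l (ctl cs) = None"
    show ?thesis
    proof (rule start_left_ctl, rule word_left_ctl[OF assms(1)[unfolded c] assms(2) instrs_superset])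
      assume "set cs \<subseteq> set (instrs p)"
      with * show "MALC_ext R (map vsym (rev (reg 0 (input x))) @ map vsym (rev (ctl cs)) @
          [letter_form p l] @ \<Delta> \<turnstile> \<gamma>)"
        by (intro letter_stack_left) (auto dest: ctl_hd)
    qed
  next
    assume *: "pops l (reg (letter_reg l) \<rho>) = None \<and> l \<in> set (letters p)"
    then have r: "letter_reg l \<in> set (regs p)"
      by (auto simp: regs_def)
    show ?thesis
    proof (rule start_left_reg[OF r], rule word_left_reg[OF assms(1)[unfolded c] r])
      fix \<Gamma>
      show "MALC_ext R (\<Gamma> @ map vsym (rev (reg (letter_reg l) \<rho>)) @ [letter_form p l] @ \<Delta> \<turnstile> \<gamma>)"
        using * reg_hd[OF r] by (intro letter_stack_left) auto
    qed
  qed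
qed

section \<open>Unfolding the star in \<open>ACT\<close>\<close>

lemma act_cut:
  "MALC_ext act_rules (\<Pi> \<turnstile> \<alpha>) \<Longrightarrow> MALC_ext act_rules (\<Gamma> @ [\<alpha>] @ \<Delta> \<turnstile> \<gamma>) \<Longrightarrow>
    MALC_ext act_rules (\<Gamma> @ \<Pi> @ \<Delta> \<turnstile> \<gamma>)"
  by (rule MALC_ext.extra[of "{\<Pi> \<turnstile> \<alpha>, \<Gamma> @ [\<alpha>] @ \<Delta> \<turnstile> \<gamma>}"]) (auto simp: act_rules_def)

lemma act_star_left:
  "MALC_ext act_rules ([] \<turnstile> \<beta>) \<Longrightarrow> MALC_ext act_rules ([\<alpha>, \<beta>] \<turnstile> \<beta>) \<Longrightarrow>
    MALC_ext act_rules ([Star \<alpha>] \<turnstile> \<beta>)"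
  by (rule MALC_ext.extra[of "{[] \<turnstile> \<beta>, [\<alpha>, \<beta>] \<turnstile> \<beta>}"]) (auto simp: act_rules_def)

lemma act_star_nil: "MALC_ext act_rules ([] \<turnstile> Star \<alpha>)"
  by (rule MALC_ext.extra[of "{}"]) (auto simp: act_rules_def)

lemma act_star_cons:
  "MALC_ext act_rules (\<Pi> \<turnstile> \<alpha>) \<Longrightarrow> MALC_ext act_rules (\<Delta> \<turnstile> Star \<alpha>) \<Longrightarrow>
    MALC_ext act_rules (\<Pi> @ \<Delta> \<turnstile> Star \<alpha>)"
  by (rule MALC_ext.extra[of "{\<Pi> \<turnstile> \<alpha>, \<Delta> \<turnstile> Star \<alpha>}"]) (auto simp: act_rules_def)

text \<open>The unfolding \<open>?\<beta>\<close> entails \<open>Star \<alpha>\<close>, so it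
  absorbs \<alpha> on the left and is an invariant for the induction rule of the star. Cut then
  carries the result into the context.\<close>

lemma act_star_unfold:
  assumes "MALC_ext act_rules (\<Gamma> @ \<Delta> \<turnstile> \<gamma>)" "MALC_ext act_rules (\<Gamma> @ [\<alpha>, Star \<alpha>] @ \<Delta> \<turnstile> \<gamma>)"
  shows "MALC_ext act_rules (\<Gamma> @ [Star \<alpha>] @ \<Delta> \<turnstile> \<gamma>)"
proof -
  let ?\<beta> = "Join One (\<alpha> \<cdot> Star \<alpha>)"
  have "MALC_ext act_rules ([\<alpha>] @ [Star \<alpha>] \<turnstile> Star \<alpha>)"
    by (intro act_star_cons MALC_ext.ax)
  then have fold: "MALC_ext act_rules ([\<alpha> \<cdot> Star \<alpha>] \<turnstile> Star \<alpha>)"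
    using MALC_ext.prodL[of _ "[]" \<alpha> "Star \<alpha>" "[]"] by simp
  have one: "MALC_ext act_rules ([One] \<turnstile> Star \<alpha>)"
    using MALC_ext.oneL[of _ "[]" "[]"] act_star_nil by simp
  have "MALC_ext act_rules ([?\<beta>] \<turnstile> Star \<alpha>)"
    using MALC_ext.joinL[of _ "[]" _ "[]"] fold one by simp
  then have "MALC_ext act_rules ([\<alpha>] @ [?\<beta>] \<turnstile> \<alpha> \<cdot> Star \<alpha>)"
    by (intro MALC_ext.prodR MALC_ext.ax)
  then have "MALC_ext act_rules ([\<alpha>, ?\<beta>] \<turnstile> ?\<beta>)"
    by (intro MALC_ext.joinR2) simp
  then have "MALC_ext act_rules ([Star \<alpha>] \<turnstile> ?\<beta>)"
    by (rule act_star_left[OF MALC_ext.joinR1[OF MALC_ext.oneR]])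
  moreover have "MALC_ext act_rules (\<Gamma> @ [?\<beta>] @ \<Delta> \<turnstile> \<gamma>)"
    by (intro MALC_ext.joinL MALC_ext.oneL MALC_ext.prodL assms)
  ultimately show ?thesis by (rule act_cut)
qed

text \<open>All runs from \<open>c\<close> are finite and none of them empties the control stack.\<close>

inductive rejects :: "letter set \<Rightarrow> config \<Rightarrow> bool" for A where
  "fst c \<noteq> [] \<Longrightarrow> (\<And>l c'. l \<in> A \<Longrightarrow> mstep l c = Some c' \<Longrightarrow> rejects A c') \<Longrightarrow> rejects A c"

text \<open>Induction along the tree of runs unfolds the star once per step. If the word ends here,
  \<open>LEnd\<close> meets a nonempty control stack; otherwise the next letter is impossible or
  extends the run \<open>w\<close>.\<close>

lemma rejects_derivable:
  assumes "rejects (set (letters p)) c" "msteps w (p, input x) = Some c" "set w \<subseteq> set (letters p)"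
  shows "MALC_ext act_rules (map vsym (rev (reg 0 (input x))) @ [start_form p] @
    map (letter_form p) w @ [Star (word_form p)] @ [letter_form p LEnd] \<turnstile> \<gamma>)"
  using assms
proof (induction arbitrary: w)
  case (1 c)
  let ?\<Gamma> = "map vsym (rev (reg 0 (input x))) @ [start_form p] @ map (letter_form p) w"
  have "MALC_ext act_rules (?\<Gamma> @ [letter_form p LEnd] \<turnstile> \<gamma>)"
    using run_error[OF 1(4,5), of LEnd _ "[]"] 1(1) by simp
  moreover have "MALC_ext act_rules (?\<Gamma> @ [word_form p] @ [Star (word_form p)] @ [letter_form p LEnd] \<turnstile> \<gamma>)"
    unfolding word_form_def
  proof (rule joins_left)
    fix \<alpha> assume "\<alpha> \<in> set (map (letter_form p) (letters p))"
    then obtain l where l: "\<alpha> = letter_form p l" "l \<in> set (letters p)" by auto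
    show "MALC_ext act_rules (?\<Gamma> @ [\<alpha>] @ [Star (joins (map (letter_form p) (letters p)))] @
        [letter_form p LEnd] \<turnstile> \<gamma>)"
    proof (cases "mstep l c")
      case None
      with run_error[OF 1(4,5), of l] l show ?thesis by simp
    next
      case (Some c')
      with 1(3)[OF l(2) Some, of "w @ [l]"] 1(4,5) l show ?thesis
        by (simp add: msteps_append word_form_def)
    qed
  qed
  ultimately show ?case
    using act_star_unfold[of ?\<Gamma> "[letter_form p LEnd]" \<gamma> "word_form p"] by simp
qed

text \<open>The machine is deterministic: the two letters of a loop have exclusive register
  conditions, so \<open>c'\<close> is the only successor of \<open>c\<close>.\<close>

lemma rejects_cstep:
  assumes "A \<subseteq> (\<Union>i. set (letters_of i))" "cstep c c'" "rejects A c'"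
  shows "rejects A c"
proof -
  obtain j cs \<rho> where c: "c = (j # cs, \<rho>)"
    using assms(2) by (cases c; cases "fst c") auto
  show ?thesis
  proof
    show "fst c \<noteq> []" using c by simp
    fix l c'' assume l: "l \<in> A" "mstep l c = Some c''"
    then obtain i where i: "l \<in> set (letters_of i)" using assms(1) by auto
    obtain q a where "l = Step i q a" using letters_of_Step[OF i] by auto
    with l(2) c have "i = j" by (auto split: if_splits)
    with i c l(2) assms(2) have "c'' = c'"
      by (cases j) (auto split: if_splits)
    with assms(3) show "rejects A c''" by simp
  qed
qed

lemma rejects_csteps:
  "csteps c c' \<Longrightarrow> A \<subseteq> (\<Union>i. set (letters_of i)) \<Longrightarrow> rejects A c' \<Longrightarrow> rejects A c"
  by (induction rule: converse_rtranclp_induct) (auto intro: rejects_cstep)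

lemma rejected_derivable:
  assumes "rec_eval f [x] 0"
  shows "run_sequent x (program_form (decider f)) \<in> ACT"
proof -
  let ?p = "decider f"
  have A: "set (letters ?p) \<subseteq> (\<Union>i. set (letters_of i))"
    by (auto simp: letters_def)
  \<comment> \<open>\<open>Dec 1\<close> offers only the action \<open>Sub 1\<close>, blocked by the
    value \<open>0\<close>: the machine is stuck with a nonempty control stack.\<close>
  have "rejects (set (letters ?p)) ([Dec 1], (input x)(1 := 0))"
  proof
    fix l c' assume l: "l \<in> set (letters ?p)" "mstep l ([Dec 1], (input x)(1 := 0)) = Some c'"
    then obtain i where i: "l \<in> set (letters_of i)" using A by auto
    then obtain q a where "l = Step i q a" using letters_of_Step by blast
    with i l(2) show "rejects (set (letters ?p)) c'"
      by (auto split: if_splits)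
  qed simp
  with rejects_csteps[OF decider_steps[OF assms] A]
  have "rejects (set (letters ?p)) (?p, input x)" by simp
  from rejects_derivable[OF this, of "[]"]
  have "MALC_ext act_rules (map vsym (rev (reg 0 (input x))) @ [start_form ?p] @
      [Star (word_form ?p)] @ [letter_form ?p LEnd] \<turnstile> Zero)"
    by simp
  then have "MALC_ext act_rules ((map vsym (rev (reg 0 (input x))) @ [start_form ?p]) @
      [Star (word_form ?p) \<cdot> letter_form ?p LEnd] @ [] \<turnstile> Zero)"
    by (intro MALC_ext.prodL) simp
  then have "MALC_ext act_rules (map vsym (rev (reg 0 (input x))) @ [program_form ?p] @ [] \<turnstile> Zero)"
    unfolding program_form_def by (intro MALC_ext.prodL) simp
  then show ?thesis
    by (simp add: ACT_def run_sequent_def map_vsym_input)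
qed

section \<open>Soundness of infinitary action logic in phase models\<close>

text \<open>Formulas denote sets of words that are closed with respect to the set of good contexts
  induced by \<open>Acc\<close>.\<close>

locale phase_model =
  fixes Acc :: "'a list set" and val :: "nat \<Rightarrow> 'a list set"
begin

text \<open>The closure operator of the Galois connection between words \<open>x\<close> and
  contexts \<open>(u, v)\<close> given by membership of \<open>u @ x @ v\<close> in
  \<open>Acc\<close>.\<close>

definition cl :: "'a list set \<Rightarrow> 'a list set" where
  "cl X = {w. \<forall>u v. (\<forall>x\<in>X. u @ x @ v \<in> Acc) \<longrightarrow> u @ w @ v \<in> Acc}"

definition closed :: "'a list set \<Rightarrow> bool" where
  "closed C \<longleftrightarrow> cl C \<subseteq> C"

definition conc :: "'a list set \<Rightarrow> 'a list set \<Rightarrow> 'a list set" where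
  "conc A B = {x @ y | x y. x \<in> A \<and> y \<in> B}"

primrec pow :: "'a list set \<Rightarrow> nat \<Rightarrow> 'a list set" where
  "pow A 0 = {[]}"
| "pow A (Suc n) = conc A (pow A n)"

text \<open>Divisions and intersections of closed sets are closed; the other connectives need
  \<open>cl\<close>. The star is generated by the finite powers, which is what validates the omega
  rule.\<close>

primrec den :: "form \<Rightarrow> 'a list set" where
  "den (Var n) = cl (val n)"
| "den Zero = cl {}"
| "den One = cl {[]}"
| "den (\<alpha> \<cdot> \<beta>) = cl (conc (den \<alpha>) (den \<beta>))"
| "den (Under \<alpha> \<beta>) = {w. \<forall>x\<in>den \<alpha>. x @ w \<in> den \<beta>}"
| "den (Over \<beta> \<alpha>) = {w. \<forall>x\<in>den \<alpha>. w @ x \<in> den \<beta>}"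
| "den (Join \<alpha> \<beta>) = cl (den \<alpha> \<union> den \<beta>)"
| "den (Meet \<alpha> \<beta>) = den \<alpha> \<inter> den \<beta>"
| "den (Star \<alpha>) = cl (\<Union>n. pow (den \<alpha>) n)"

primrec dens :: "form list \<Rightarrow> 'a list set" where
  "dens [] = {[]}"
| "dens (\<alpha> # \<Gamma>) = conc (den \<alpha>) (dens \<Gamma>)"

primrec valid :: "sequent \<Rightarrow> bool" where
  "valid (\<Gamma> \<turnstile> \<gamma>) \<longleftrightarrow> dens \<Gamma> \<subseteq> den \<gamma>"

section \<open>Closed sets and validity in contexts\<close>

lemma cl_superset: "X \<subseteq> cl X"
  by (auto simp: cl_def)

lemma cl_mono: "X \<subseteq> Y \<Longrightarrow> cl X \<subseteq> cl Y"
  by (simp add: cl_def subset_iff)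

lemma closed_cl: "closed (cl X)"
  unfolding closed_def cl_def by blast

text \<open>Contexts compose: a context around \<open>C\<close> extends \<open>u\<close> and
  \<open>v\<close> to a context around \<open>X\<close>. Hence left rules need checking only on the
  generators of a closure.\<close>

lemma closed_context:
  assumes "closed C" "\<And>x. x \<in> X \<Longrightarrow> u @ x @ v \<in> C" "w \<in> cl X"
  shows "u @ w @ v \<in> C"
proof -
  have "u @ w @ v \<in> cl C"
    unfolding cl_def
  proof (intro CollectI allI impI)
    fix u' v' assume *: "\<forall>x\<in>C. u' @ x @ v' \<in> Acc"
    have "(u' @ u) @ w @ (v @ v') \<in> Acc"
    proof -
      have "\<forall>x\<in>X. (u' @ u) @ x @ (v @ v') \<in> Acc"
        using * assms(2) by (metis append.assoc)
      then show ?thesis using assms(3) unfolding cl_def by blast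
    qed
    then show "u' @ (u @ w @ v) @ v' \<in> Acc" by simp
  qed
  then show ?thesis using assms(1) by (auto simp: closed_def)
qed

lemma closed_den: "closed (den \<alpha>)"
proof (induction \<alpha>)
  case (Under \<alpha> \<beta>)
  have "x @ w @ [] \<in> den \<beta>" if "w \<in> cl (den (Under \<alpha> \<beta>))" "x \<in> den \<alpha>" for x w
    by (rule closed_context[OF Under(2) _ that(1)]) (use that(2) in auto)
  then show ?case by (auto simp: closed_def)
next
  case (Over \<beta> \<alpha>)
  have "[] @ w @ x \<in> den \<beta>" if "w \<in> cl (den (Over \<beta> \<alpha>))" "x \<in> den \<alpha>" for x w
    by (rule closed_context[OF Over(1) _ that(1)]) (use that(2) in auto)
  then show ?case by (auto simp: closed_def)
next
  case (Meet \<alpha> \<beta>)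
  then show ?case
    unfolding closed_def den.simps by (meson cl_mono inf_le1 inf_le2 le_inf_iff order_trans)
qed (simp_all add: closed_cl)

lemma ball_conc: "(\<forall>w\<in>conc A B. P w) \<longleftrightarrow> (\<forall>x\<in>A. \<forall>y\<in>B. P (x @ y))"
  unfolding conc_def by blast

lemma conc_Nil: "conc {[]} A = A" "conc A {[]} = A"
  by (auto simp: conc_def)

lemma conc_assoc: "conc (conc A B) C = conc A (conc B C)"
  unfolding conc_def by (auto, metis append.assoc, metis append.assoc)

lemma conc_mono: "A \<subseteq> A' \<Longrightarrow> B \<subseteq> B' \<Longrightarrow> conc A B \<subseteq> conc A' B'"
  by (auto simp: conc_def)

lemma dens_append: "dens (\<Gamma> @ \<Delta>) = conc (dens \<Gamma>) (dens \<Delta>)"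
  by (induction \<Gamma>) (auto simp: conc_Nil conc_assoc)

lemma dens_single: "dens [\<alpha>] = den \<alpha>"
  by (simp add: conc_Nil)

lemma dens_replicate: "dens (replicate n \<alpha>) = pow (den \<alpha>) n"
  by (induction n) auto

lemma valid_context:
  "valid (\<Gamma> @ \<Pi> @ \<Delta> \<turnstile> \<gamma>) \<longleftrightarrow> (\<forall>u\<in>dens \<Gamma>. \<forall>x\<in>dens \<Pi>. \<forall>v\<in>dens \<Delta>. u @ x @ v \<in> den \<gamma>)"
  by (simp only: valid.simps dens_append subset_eq ball_conc)

lemma valid_cl:
  assumes "\<And>u x v. u \<in> dens \<Gamma> \<Longrightarrow> x \<in> X \<Longrightarrow> v \<in> dens \<Delta> \<Longrightarrow> u @ x @ v \<in> den \<gamma>"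
    and "dens \<Pi> \<subseteq> cl X"
  shows "valid (\<Gamma> @ \<Pi> @ \<Delta> \<turnstile> \<gamma>)"
  unfolding valid_context
  using assms closed_context[OF closed_den] by blast

lemma valid_concat: "(\<And>\<Pi>. \<Pi> \<in> set \<Pi>s \<Longrightarrow> valid (\<Pi> \<turnstile> \<alpha>)) \<Longrightarrow> dens (concat \<Pi>s) \<subseteq> pow (den \<alpha>) (length \<Pi>s)"
proof (induction \<Pi>s)
  case (Cons \<Pi> \<Pi>s)
  then have "dens \<Pi> \<subseteq> den \<alpha>" "dens (concat \<Pi>s) \<subseteq> pow (den \<alpha>) (length \<Pi>s)"
    by simp_all
  then show ?case
    by (simp add: dens_append conc_mono)
qed simp

theorem soundness: "MALC_ext omega_rules s \<Longrightarrow> valid s"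
proof (induction rule: MALC_ext.induct)
  case (ax \<alpha>)
  then show ?case by (simp add: conc_Nil)
next
  case (zeroL \<Gamma> \<Delta> \<gamma>)
  show ?case by (rule valid_cl[of _ "{}"]) (auto simp: conc_Nil)
next
  case oneR
  then show ?case using cl_superset[of "{[]}"] by auto
next
  case (oneL \<Gamma> \<Delta> \<gamma>)
  have "valid (\<Gamma> @ [] @ \<Delta> \<turnstile> \<gamma>)" using oneL by simp
  then show ?case
    by (intro valid_cl[of _ "{[]}"]) (auto simp only: valid_context dens.simps conc_Nil den.simps)
next
  case (underL \<Pi> \<alpha> \<Gamma> \<beta> \<Delta> \<gamma>)
  have "valid (\<Gamma> @ (\<Pi> @ [Under \<alpha> \<beta>]) @ \<Delta> \<turnstile> \<gamma>)"
    unfolding valid_context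
  proof (intro ballI)
    fix u x v assume *: "u \<in> dens \<Gamma>" "x \<in> dens (\<Pi> @ [Under \<alpha> \<beta>])" "v \<in> dens \<Delta>"
    then have "x \<in> den \<beta>"
      using underL(3) by (fastforce simp: dens_append conc_def)
    then show "u @ x @ v \<in> den \<gamma>"
      using underL(4) * unfolding valid_context dens_single by blast
  qed
  then show ?case by simp
next
  case (overL \<Pi> \<alpha> \<Gamma> \<beta> \<Delta> \<gamma>)
  have "valid (\<Gamma> @ ([Over \<beta> \<alpha>] @ \<Pi>) @ \<Delta> \<turnstile> \<gamma>)"
    unfolding valid_context
  proof (intro ballI)
    fix u x v assume *: "u \<in> dens \<Gamma>" "x \<in> dens ([Over \<beta> \<alpha>] @ \<Pi>)" "v \<in> dens \<Delta>"
    then have "x \<in> den \<beta>"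
      using overL(3) by (fastforce simp: dens_append conc_def)
    then show "u @ x @ v \<in> den \<gamma>"
      using overL(4) * unfolding valid_context dens_single by blast
  qed
  then show ?case by simp
next
  case (underR \<alpha> \<Pi> \<beta>)
  then show ?case by (fastforce simp: conc_def)
next
  case (overR \<Pi> \<alpha> \<beta>)
  then show ?case by (fastforce simp: conc_def dens_append)
next
  case (prodL \<Gamma> \<alpha> \<beta> \<Delta> \<gamma>)
  then show ?case
    by (intro valid_cl[of _ "conc (den \<alpha>) (den \<beta>)"])
      (auto simp only: valid_context dens.simps conc_Nil den.simps)
next
  case (prodR \<Gamma> \<alpha> \<Delta> \<beta>)
  then have "dens (\<Gamma> @ \<Delta>) \<subseteq> conc (den \<alpha>) (den \<beta>)"
    unfolding dens_append valid.simps by (intro conc_mono)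
  then show ?case using cl_superset by (simp, blast)
next
  case (meetL1 \<Gamma> \<alpha> \<Delta> \<gamma> \<beta>)
  then show ?case unfolding valid_context by (simp add: conc_Nil)
next
  case (meetL2 \<Gamma> \<beta> \<Delta> \<gamma> \<alpha>)
  then show ?case unfolding valid_context by (simp add: conc_Nil)
next
  case (meetR \<Pi> \<alpha> \<beta>)
  then show ?case by simp
next
  case (joinL \<Gamma> \<alpha> \<Delta> \<gamma> \<beta>)
  then show ?case
    by (intro valid_cl[of _ "den \<alpha> \<union> den \<beta>"])
      (auto simp only: valid_context dens.simps conc_Nil den.simps)
next
  case (joinR1 \<Pi> \<alpha> \<beta>)
  then show ?case using cl_superset[of "den \<alpha> \<union> den \<beta>"] by auto
next
  case (joinR2 \<Pi> \<beta> \<alpha>)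
  then show ?case using cl_superset[of "den \<alpha> \<union> den \<beta>"] by auto
next
  case (extra P s)
  from extra(1) consider
    (star) \<Gamma> \<alpha> \<Delta> \<gamma> where "P = {\<Gamma> @ replicate n \<alpha> @ \<Delta> \<turnstile> \<gamma> | n. True}" "s = (\<Gamma> @ [Star \<alpha>] @ \<Delta> \<turnstile> \<gamma>)"
  | (concat) \<Pi>s \<alpha> where "P = {\<Pi> \<turnstile> \<alpha> | \<Pi>. \<Pi> \<in> set \<Pi>s}" "s = (concat \<Pi>s \<turnstile> Star \<alpha>)"
    unfolding omega_rules_def by blast
  then show ?case
  proof cases
    case star
    have "valid (\<Gamma> @ replicate n \<alpha> @ \<Delta> \<turnstile> \<gamma>)" for n
      by (rule extra(3)) (auto simp: star(1))
    then show ?thesis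
      unfolding star(2) by (intro valid_cl[of _ "\<Union>n. pow (den \<alpha>) n"])
        (auto simp only: valid_context dens.simps conc_Nil den.simps dens_replicate)
  next
    case concat
    have "dens (concat \<Pi>s) \<subseteq> pow (den \<alpha>) (length \<Pi>s)"
      by (rule valid_concat, rule extra(3)) (auto simp: concat(1))
    then show ?thesis
      unfolding concat(2) using cl_superset[of "\<Union>n. pow (den \<alpha>) n"] by auto
  qed
qed

end

section \<open>Accepting runs refute derivability\<close>

datatype tok = TSym sym | TLet letter | TStart

text \<open>Nondeterministic only at \<open>TStart\<close>; stacks are listed from the top. Once an
  error is found, the rest of the word is ignored.\<close>

fun errs :: "sym list list \<Rightarrow> tok list \<Rightarrow> sym list \<Rightarrow> bool" where
  "errs ss [] s \<longleftrightarrow> False"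
| "errs ss (TSym Z # w) s \<longleftrightarrow> errs ss w (Z # s)"
| "errs ss (TLet l # w) s \<longleftrightarrow> (case pops l s of None \<Rightarrow> True | Some s' \<Rightarrow> errs ss w s')"
| "errs ss (TStart # w) s \<longleftrightarrow> (\<exists>t\<in>set ss. errs ss w (t @ s))"

text \<open>A prefix influences the rest only through the stack that it leaves, so comparisons in
  all contexts reduce to comparisons of suffixes.\<close>

lemma errs_mono: "(\<And>s. errs ss w s \<Longrightarrow> errs ss w' s) \<Longrightarrow> errs ss (u @ w) s \<Longrightarrow> errs ss (u @ w') s"
  by (induction ss u s rule: errs.induct) (auto split: option.splits)

lemma errs_prefix: "ss \<noteq> [] \<Longrightarrow> (\<And>s. errs ss w s) \<Longrightarrow> errs ss (u @ w) s"
  by (induction ss u s rule: errs.induct) (auto split: option.splits simp: ex_in_conv)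

lemma errs_syms: "errs ss (map TSym zs @ w) s \<longleftrightarrow> errs ss w (rev zs @ s)"
  by (induction zs arbitrary: s) auto

text \<open>With this choice of \<open>Acc\<close>, \<open>Zero\<close> denotes the words that allow
  an error to be found in every context.\<close>

abbreviation err_words :: "instr list \<Rightarrow> tok list set" where
  "err_words p \<equiv> {w. errs (starts p) w []}"

abbreviation sym_val :: "nat \<Rightarrow> tok list set" where
  "sym_val n \<equiv> {[TSym (from_nat n)]}"

context
  fixes p :: "instr list"
begin

interpretation phase_model "err_words p" sym_val .

lemma vsym_den: "[TSym Z] \<in> den (vsym Z)"
  using cl_superset[of "sym_val (to_nat Z)"] by (simp add: vsym_def)

lemma meets_den: "(\<And>\<alpha>. \<alpha> \<in> set \<alpha>s \<Longrightarrow> w \<in> den \<alpha>) \<Longrightarrow> w \<in> den (meets \<alpha>s)"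
proof (induction \<alpha>s)
  case Nil
  \<comment> \<open>\<open>cl {}\<close> absorbs concatenation, so \<open>Under Zero Zero\<close>
    denotes all words.\<close>
  have "x @ w @ [] \<in> cl {}" if "x \<in> cl {}" for x
    using closed_context[OF closed_cl[of "{}"] _ that, of "[]" w] by simp
  then show ?case by (simp add: meets_def)
qed (simp add: meets_def)

lemma joins_den: "\<alpha> \<in> set \<alpha>s \<Longrightarrow> w \<in> den \<alpha> \<Longrightarrow> w \<in> den (joins \<alpha>s)"
proof (induction \<alpha>s)
  case (Cons \<beta> \<alpha>s)
  then show ?case
    using cl_superset[of "den \<beta> \<union> den (joins \<alpha>s)"] by (auto simp: joins_def)
qed simp

lemma prods_den: "cl {map TSym zs} \<subseteq> den (prods zs)"
proof -
  have "map TSym zs \<in> den (prods zs)"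
  proof (induction zs)
    case Nil
    then show ?case using cl_superset by (auto simp: prods_def)
  next
    case (Cons z zs)
    then have "[TSym z] @ map TSym zs \<in> conc (den (vsym z)) (den (prods zs))"
      using vsym_den unfolding conc_def by blast
    then show ?case
      using cl_superset[of "conc (den (vsym z)) (den (prods zs))"] by (auto simp: prods_def)
  qed
  then have "cl {map TSym zs} \<subseteq> cl (den (prods zs))"
    by (intro cl_mono) simp
  then show ?thesis
    using closed_den[of "prods zs"] by (auto simp: closed_def)
qed

text \<open>Reading \<open>Z\<close> and then \<open>l\<close> is an error or has the effect of
  pushing \<open>s\<close>, where \<open>trans l Z = Some s\<close>. This is what the conjunct for
  \<open>Z\<close> demands.\<close>

lemma letter_den: "[TLet l] \<in> den (letter_form p l)"
  unfolding letter_form_def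
proof (rule meets_den)
  fix \<alpha> assume "\<alpha> \<in> set (map (rule_form l) (syms p))"
  then obtain Z where \<alpha>: "\<alpha> = rule_form l Z" by auto
  let ?\<beta> = "case trans l Z of None \<Rightarrow> Zero | Some s \<Rightarrow> prods (rev s)"
  have Z: "[TSym Z, TLet l] \<in> den ?\<beta>"
  proof (cases "trans l Z")
    case None
    have "errs (starts p) (u @ [TSym Z, TLet l] @ v) []" for u v
      by (rule errs_prefix) (auto simp: None starts_def)
    then show ?thesis by (simp add: None cl_def)
  next
    case (Some s)
    have "errs (starts p) (u @ map TSym (rev s) @ v) [] \<Longrightarrow>
        errs (starts p) (u @ [TSym Z, TLet l] @ v) []" for u v
      by (rule errs_mono[rotated]) (auto simp: Some errs_syms)
    then have "[TSym Z, TLet l] \<in> cl {map TSym (rev s)}"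
      by (auto simp: cl_def)
    then show ?thesis using prods_den Some by auto
  qed
  \<comment> \<open>\<open>vsym Z\<close> denotes the closure of a single word, so that word alone
    has to be checked.\<close>
  have "[] @ x @ [TLet l] \<in> den ?\<beta>" if "x \<in> den (vsym Z)" for x
    by (rule closed_context[OF closed_den, of "{[TSym Z]}"])
      (use that Z in \<open>auto simp: vsym_def\<close>)
  then show "[TLet l] \<in> den \<alpha>" by (simp add: \<alpha> rule_form_def)
qed

text \<open>The automaton chooses the start stack itself, so an error found after pushing any one of
  them is also found after \<open>TStart\<close>.\<close>

lemma start_den: "[TStart] \<in> den (start_form p)"
  unfolding start_form_def
proof (rule meets_den)
  fix \<alpha> assume "\<alpha> \<in> set (map (\<lambda>s. prods (rev s)) (starts p))"
  then obtain s where s: "\<alpha> = prods (rev s)" "s \<in> set (starts p)" by auto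
  have "errs (starts p) (u @ map TSym (rev s) @ v) [] \<Longrightarrow> errs (starts p) (u @ [TStart] @ v) []" for u v
    by (rule errs_mono[rotated]) (use s(2) in \<open>auto simp: errs_syms\<close>)
  then have "[TStart] \<in> cl {map TSym (rev s)}"
    by (auto simp: cl_def)
  then show "[TStart] \<in> den \<alpha>" using prods_den s(1) by auto
qed

lemma word_den: "set w \<subseteq> set (letters p) \<Longrightarrow> map TLet w \<in> den (Star (word_form p))"
proof -
  assume "set w \<subseteq> set (letters p)"
  then have "map TLet w \<in> pow (den (word_form p)) (length w)"
  proof (induction w)
    case (Cons l w)
    then have "[TLet l] \<in> den (word_form p)"
      unfolding word_form_def by (intro joins_den[OF _ letter_den]) auto
    with Cons have "[TLet l] @ map TLet w \<in> conc (den (word_form p)) (pow (den (word_form p)) (length w))"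
      unfolding conc_def by (intro CollectI exI conjI) auto
    then show ?case by simp
  qed simp
  then show ?thesis
    using cl_superset[of "\<Union>n. pow (den (word_form p)) n"] by auto
qed

text \<open>The token word of the run lies in the denotation of the antecedent, so soundness puts it
  into that of \<open>Zero\<close>.\<close>

lemma derivable_errs:
  assumes "run_sequent x (program_form p) \<in> ACT_omega" "set w \<subseteq> set (letters p)"
  shows "\<exists>s\<in>set (starts p). errs (starts p) (map TLet (w @ [LEnd])) (s @ reg 0 (input x))"
proof -
  have "map TLet w @ [TLet LEnd] \<in> conc (den (Star (word_form p))) (den (letter_form p LEnd))"
    using word_den[OF assms(2)] letter_den unfolding conc_def by blast
  then have "map TLet w @ [TLet LEnd] \<in> den (Star (word_form p) \<cdot> letter_form p LEnd)"
    using cl_superset by (simp only: den.simps, blast)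
  then have "[TStart] @ map TLet w @ [TLet LEnd]
      \<in> conc (den (start_form p)) (den (Star (word_form p) \<cdot> letter_form p LEnd))"
    using start_den unfolding conc_def by blast
  then have "[TStart] @ map TLet w @ [TLet LEnd] \<in> dens [program_form p]"
    using cl_superset unfolding program_form_def dens_single by (simp only: den.simps, blast)
  moreover have "map TSym zs \<in> dens (map vsym zs)" for zs
  proof (induction zs)
    case (Cons z zs)
    then have "[TSym z] @ map TSym zs \<in> conc (den (vsym z)) (dens (map vsym zs))"
      using vsym_den unfolding conc_def by blast
    then show ?case by simp
  qed simp
  ultimately have "map TSym (rev (reg 0 (input x))) @ [TStart] @ map TLet w @ [TLet LEnd]
      \<in> dens (map vsym (rev (reg 0 (input x))) @ [program_form p])"
    unfolding dens_append conc_def by blast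
  moreover have "valid (map vsym (rev (reg 0 (input x))) @ [program_form p] \<turnstile> Zero)"
    using soundness[of "run_sequent x (program_form p)"] assms(1)
    by (simp only: ACT_omega_def mem_Collect_eq run_sequent_def map_vsym_input append_assoc)
  ultimately have "map TSym (rev (reg 0 (input x))) @ [TStart] @ map TLet w @ [TLet LEnd] \<in> cl {}"
    by auto
  \<comment> \<open>The empty context is among those over which \<open>cl {}\<close>
    quantifies.\<close>
  then have "[] @ (map TSym (rev (reg 0 (input x))) @ [TStart] @ map TLet w @ [TLet LEnd]) @ []
      \<in> err_words p"
    unfolding cl_def by blast
  then show ?thesis by (simp add: errs_syms)
qed

end

text \<open>A legal run shows no error on its own stores and turns each into that of the final
  configuration; what lies below, \<open>t\<close>, stays untouched.\<close>

lemma msteps_no_errs: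
  assumes "msteps w (cs, \<rho>) = Some (cs', \<rho>')"
  shows "errs ss (map TLet w @ v) (ctl cs @ t) \<longleftrightarrow> errs ss v (ctl cs' @ t)"
    and "errs ss (map TLet w @ v) (reg r \<rho> @ t) \<longleftrightarrow> errs ss v (reg r \<rho>' @ t)"
proof -
  have ne: "ctl cs \<noteq> []" "reg r \<rho> \<noteq> []" for cs \<rho>
    by (auto simp: ctl_def reg_def)
  have "(errs ss (map TLet w @ v) (ctl cs @ t) \<longleftrightarrow> errs ss v (ctl cs' @ t)) \<and>
      (errs ss (map TLet w @ v) (reg r \<rho> @ t) \<longleftrightarrow> errs ss v (reg r \<rho>' @ t))"
    using assms
  proof (induction w arbitrary: cs \<rho>)
    case (Cons l w)
    then obtain cs1 \<rho>1 where 1: "mstep l (cs, \<rho>) = Some (cs1, \<rho>1)"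
      "msteps w (cs1, \<rho>1) = Some (cs', \<rho>')"
      by (auto split: bind_splits)
    show ?case
      using Cons.IH[OF 1(2)] pops_ctl[OF 1(1)] pops_reg[OF 1(1)] by (simp add: pops_append[OF ne(1)] pops_append[OF ne(2)])
  qed simp
  then show "errs ss (map TLet w @ v) (ctl cs @ t) \<longleftrightarrow> errs ss v (ctl cs' @ t)"
    "errs ss (map TLet w @ v) (reg r \<rho> @ t) \<longleftrightarrow> errs ss v (reg r \<rho>' @ t)"
    by auto
qed

lemma csteps_word:
  assumes "csteps c c'" "set (fst c) \<subseteq> set (instrs p)"
  shows "\<exists>w. set w \<subseteq> set (letters p) \<and> msteps w c = Some c'"
  using assms
proof (induction rule: converse_rtranclp_induct)
  case base
  show ?case by (rule exI[of _ "[]"]) simp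
next
  case (step c d)
  obtain j cs \<rho> where c: "c = (j # cs, \<rho>)"
    using step(1) by (cases c; cases "fst c") auto
  with step(1) obtain l where l: "l \<in> set (letters_of j)" "mstep l c = Some d" by auto
  have lp: "l \<in> set (letters p)"
    using l(1) step(4) c by (auto simp: letters_def)
  then have "set (fst d) \<subseteq> set (instrs p)"
    using mstep_closed[of l "j # cs" \<rho> "fst d" "snd d" p] l(2) c step(4) by simp
  with step(3) obtain w where "set w \<subseteq> set (letters p)" "msteps w d = Some c'" by blast
  with l(2) lp show ?case by (intro exI[of _ "l # w"]) simp
qed

text \<open>The accepting run followed by \<open>LEnd\<close> passes every check: the control stack
  ends as \<open>Ctl\<close>, and no register objects to \<open>LEnd\<close>. This contradicts
  \<open>derivable_errs\<close>.\<close>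

lemma accepted_not_derivable:
  assumes "rec_eval f [x] (Suc y)"
  shows "run_sequent x (program_form (decider f)) \<notin> ACT_omega"
proof
  let ?p = "decider f"
  assume derivable: "run_sequent x (program_form ?p) \<in> ACT_omega"
  have last: "cstep ([Dec 1], (input x)(1 := Suc y)) ([], (input x)(1 := y))"
    by simp
  have "set ?p \<subseteq> set (instrs ?p)"
    by (rule instrs_superset)
  then obtain w where w: "set w \<subseteq> set (letters ?p)"
    "msteps w (?p, input x) = Some ([], (input x)(1 := y))"
    using csteps_word[OF rtranclp.rtrancl_into_rtrancl[OF decider_steps[OF assms] last], of ?p] by auto
  obtain s where s: "s \<in> set (starts ?p)"
    "errs (starts ?p) (map TLet w @ [TLet LEnd]) (s @ reg 0 (input x))"
    using derivable_errs[OF derivable w(1)] by auto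
  note run = msteps_no_errs[OF w(2)]
  have reg_end: "\<not> errs ss [TLet LEnd] (reg r \<rho> @ t)" for ss r \<rho> t
    by (cases "\<rho> r") (auto simp: reg_def)
  from s(1) consider "s = []" | "s = ctl ?p" | r where "r \<noteq> 0" "s = [Bot r]"
    by (auto simp: starts_def)
  then show False
  proof cases
    case 1
    then show False
      using s(2) run(2)[of _ _ 0 "[]"] reg_end[of _ 0 _ "[]"] by simp
  next
    case 2
    then show False
      using s(2) run(1) by (simp add: ctl_def)
  next
    case 3
    then have "s = reg r (input x)"
      by (simp add: reg_def input_def)
    then show False
      using s(2) run(2) reg_end by simp
  qed
qed

section \<open>Undecidability\<close>

theorem theorem2:
  fixes L :: "sequent set"
  assumes "ACT \<subseteq> L" and "L \<subseteq> ACT_omega"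
  shows "\<not> decidable L"
proof
  assume "decidable L"
  then obtain d where d: "\<And>n. rec_eval d [n] (if n \<in> sequent_code ` L then 1 else 0)"
    unfolding decidable_def recursive_set_def by blast
  obtain g where g: "\<And>\<gamma>. rec_eval g [form_code \<gamma>] (sequent_code (run_sequent (form_code \<gamma>) \<gamma>))"
    using rec_eval_diag_code[of "vsym (Bot 0)" "vsym (Cnt 0)" Zero, folded run_sequent_def] by blast
  \<comment> \<open>\<open>g\<close> sends the code of a formula to the code of its own sequent. The
    machine inside \<gamma>, run on the code of \<gamma>, thus computes membership of
    \<open>?s\<close> in \<open>L\<close>, while \<open>?s\<close> says that this run does not
    accept.\<close>
  define \<gamma> where "\<gamma> = program_form (decider (Comp1 d g))"
  let ?s = "run_sequent (form_code \<gamma>) \<gamma>"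
  have run: "rec_eval (Comp1 d g) [form_code \<gamma>] (if ?s \<in> L then 1 else 0)"
    using rec_eval_Comp1[OF g d] by (simp add: inj_image_mem_iff[OF inj_sequent_code])
  show False
  proof (cases "?s \<in> L")
    case True
    with run have "?s \<notin> ACT_omega"
      unfolding \<gamma>_def by (intro accepted_not_derivable[of _ _ 0]) simp
    with True assms(2) show False by blast
  next
    case False
    with run have "?s \<in> ACT"
      unfolding \<gamma>_def by (intro rejected_derivable) simp
    with False assms(1) show False by blast
  qed
qed

end
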